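(* Let $d\ge 1$, let $n_1,\dots,n_d$ be positive integers and let $\mathbf r=(r_1,\dots,r_d)$ be positive integers with $r_k\le n_k$ for all $k$. The set $$\mathcal M=\left\{(\mathcal X,\mathbf P_1,\dots,\mathbf P_d):\ \mathcal X\in\mathbb R^{n_1\times\cdots\times n_d},\ \mathbf P_k\in\mathrm{Gr}(n_k-r_k,n_k),\ \mathcal X\times_k\mathbf P_k=0\ \text{ for } k=1,\dots,d\right\}$$ is a smooth manifold, namely an embedded submanifold of $\mathcal E=\mathbb R^{n_1\times\cdots\times n_d}\times\mathrm{Sym}(n_1)\times\cdots\times\mathrm{Sym}(n_d)$, with dimension $r_1r_2\cdots r_d+\sum_{k=1}^d r_k(n_k-r_k)$.
   Context: $\mathrm{Sym}(n)$ is the space of real symmetric $n\times n$ matrices. $\mathrm{Gr}(s,n)=\{\mathbf P\in\mathrm{Sym}(n):\mathrm{rank}(\mathbf P)=s,\ \mathbf P=\mathbf P^2\}$ (Grassmann manifold as rank-$s$ orthogonal projectors). For $\mathcal X\in\mathbb R^{n_1\times\cdots\times n_d}$ and $\mathbf A\in\mathbb R^{M\times n_k}$, the $k$-mode product $\mathcal X\times_k\mathbf A\in\mathbb R^{n_1\times\cdots\times M\times\cdots\times n_d}$ has entries $(\mathcal X\times_k\mathbf A)(i_1,\dots,i_{k-1},j,i_{k+1},\dots,i_d)=\sum_{i_k=1}^{n_k}\mathbf A(j,i_k)\mathcal X(i_1,\dots,i_d)$. *)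

theory Defs
  imports "HOL-Analysis.Analysis"
begin

text \<open>
  Maps of class \<open>C\<^sup>k\<close> on a relatively open subset \<open>S\<close> of a linear subspace \<open>E\<close> of a Euclidean
  space. Derivatives are taken within \<open>S\<close>, so the linear map \<open>f' x\<close> is determined by \<open>f\<close> only
  in the directions \<open>v \<in> E\<close>; the recursion uses no other directions. As \<open>E\<close> is
  finite-dimensional, asking that \<open>\<lambda>x. f' x v\<close> is of class \<open>C\<^sup>k\<close> for all \<open>v \<in> E\<close> is the same as
  asking it of the derivative as an operator-valued map.
\<close>

primrec Ck_on :: "nat \<Rightarrow> 'a::euclidean_space set \<Rightarrow> 'a set \<Rightarrow> ('a \<Rightarrow> 'b::real_normed_vector) \<Rightarrow> bool"
  where
    "Ck_on 0 E S f \<longleftrightarrow> continuous_on S f"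
  | "Ck_on (Suc k) E S f \<longleftrightarrow>
       (\<exists>f'. (\<forall>x\<in>S. (f has_derivative f' x) (at x within S)) \<and>
             (\<forall>v\<in>E. Ck_on k E S (\<lambda>x. f' x v)))"

definition smooth_on :: "'a::euclidean_space set \<Rightarrow> 'a set \<Rightarrow> ('a \<Rightarrow> 'b::real_normed_vector) \<Rightarrow> bool"
  where "smooth_on E S f \<longleftrightarrow> (\<forall>k. Ck_on k E S f)"

text \<open>
  Embedded submanifolds of dimension \<open>m\<close> of the linear space \<open>E\<close>, given by slice charts: around
  every point of \<open>M\<close> there is a smooth diffeomorphism \<open>\<phi>\<close> between open subsets \<open>U\<close> and \<open>V\<close> of
  \<open>E\<close> that carries \<open>U \<inter> M\<close> onto the part of an \<open>m\<close>-dimensional linear subspace \<open>L\<close> lying in \<open>V\<close>.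
  In a basis of \<open>E\<close> extending one of \<open>L\<close>, this is the usual slice condition with the model
  \<open>\<real>\<^sup>m \<times> {0}\<close>. The restrictions of the maps \<open>\<phi>\<close> to \<open>U \<inter> M\<close> form the smooth atlas of \<open>M\<close> for
  the subspace topology. \<open>M\<close> is required to be nonempty, since the empty set would
  have every dimension.
\<close>

definition embedded_submanifold :: "'a::euclidean_space set \<Rightarrow> 'a set \<Rightarrow> nat \<Rightarrow> bool"
  where
    "embedded_submanifold E M m \<longleftrightarrow>
       subspace E \<and> M \<subseteq> E \<and> M \<noteq> {} \<and>
       (\<forall>p\<in>M. \<exists>U V L \<phi> \<psi>.
          openin (top_of_set E) U \<and> p \<in> U \<and> openin (top_of_set E) V \<and>
          homeomorphism U V \<phi> \<psi> \<and> smooth_on E U \<phi> \<and> smooth_on E V \<psi> \<and>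
          subspace L \<and> L \<subseteq> E \<and> dim L = m \<and>
          \<phi> ` (U \<inter> M) = V \<inter> L)"

text \<open>
  The dimensions \<open>n\<^sub>k\<close> may differ from mode to mode, so mode \<open>k :: 'd\<close> is indexed by a subset
  \<open>I k\<close> of one finite type \<open>'n\<close>, with \<open>n\<^sub>k = card (I k)\<close>. An array with entries indexed by the
  sets \<open>I k\<close> is represented by its extension by zero. A multi-index is a function
  \<open>i :: 'd \<Rightarrow> 'n\<close> with \<open>i k \<in> I k\<close> for all \<open>k\<close>. Extension by zero changes neither rank
  nor matrix products.
\<close>

definition tensors :: "('d::finite \<Rightarrow> 'n::finite set) \<Rightarrow> (real ^ ('d \<Rightarrow> 'n)) set"
  where "tensors I = {X. \<forall>i. (\<exists>k. i k \<notin> I k) \<longrightarrow> X $ i = 0}"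

definition Sym :: "'n::finite set \<Rightarrow> (real ^ 'n ^ 'n) set"
  where "Sym J = {A. transpose A = A \<and> (\<forall>i j. i \<notin> J \<or> j \<notin> J \<longrightarrow> A $ i $ j = 0)}"

definition Gr :: "nat \<Rightarrow> 'n::finite set \<Rightarrow> (real ^ 'n ^ 'n) set"
  where "Gr s J = {P \<in> Sym J. rank P = s \<and> P = P ** P}"

text \<open>
  The \<open>k\<close>-mode product. The sum over all of \<open>'n\<close> is the sum over \<open>I k\<close> if \<open>X \<in> tensors I\<close>.
\<close>

definition mode_prod ::
    "real ^ ('d::finite \<Rightarrow> 'n::finite) \<Rightarrow> 'd \<Rightarrow> real ^ 'n ^ 'n \<Rightarrow> real ^ ('d \<Rightarrow> 'n)"
  where "mode_prod X k A = (\<chi> i. \<Sum>l\<in>UNIV. A $ (i k) $ l * X $ (i(k := l)))"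

definition ambient_space ::
    "('d::finite \<Rightarrow> 'n::finite set) \<Rightarrow> ((real ^ ('d \<Rightarrow> 'n)) \<times> (real ^ 'n ^ 'n ^ 'd)) set"
  where "ambient_space I = tensors I \<times> {P. \<forall>k. P $ k \<in> Sym (I k)}"

definition desingularization ::
    "('d::finite \<Rightarrow> 'n::finite set) \<Rightarrow> ('d \<Rightarrow> nat) \<Rightarrow>
      ((real ^ ('d \<Rightarrow> 'n)) \<times> (real ^ 'n ^ 'n ^ 'd)) set"
  where
    "desingularization I r =
       {(X, P). X \<in> tensors I \<and>
          (\<forall>k. P $ k \<in> Gr (card (I k) - r k) (I k) \<and> mode_prod X k (P $ k) = 0)}"

end

theory Submission
  imports Defs
begin

text \<open>
  Both the slice charts and their inverses are given by closed formulas, so no inverse function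
  theorem is needed. In blocks along \<open>range P \<oplus> ker P\<close>, a symmetric matrix near the projection \<open>P\<close>
  factors uniquely as \<open>S = [[1, 0], [Z, 1]] [[A, 0], [0, C]] [[1, Z\<^sup>T], [0, 1]]\<close>, and \<open>S\<close> is a
  projection of the same rank iff \<open>C = 0\<close> and \<open>A = (1 + Z\<^sup>T Z)\<^sup>-\<^sup>1\<close>. Hence
  \<open>(A - (1 + Z\<^sup>T Z)\<^sup>-\<^sup>1, Z, C)\<close> are slice coordinates. The unipotent matrix \<open>[[1, Z\<^sup>T], [0, 1]]\<close> maps
  \<open>ker S\<close> onto \<open>ker P\<close>, so applying it in every mode straightens the conditions \<open>X \<times>\<^sub>k S\<^sub>k = 0\<close>
  simultaneously. The model space is the range of an orthogonal projection, whose dimension is its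
  trace.
\<close>

section \<open>Calculus of smooth maps\<close>

text \<open>The equations \<open>X x_k P_k = 0\<close> overlap as soon as \<open>r k < n k\<close>
  for two modes: counted mode by mode they exceed the codimension, so the set is not a regular level
  set of this system. Straightening avoids the count. With \<open>N = [[0, Z^T], [0, 0]]\<close> and
  \<open>K = P (1 + N)\<close>, the projection \<open>S\<close> is \<open>K^T (K K^T)^-1 K\<close>,
  the inverse being taken on range \<open>P\<close>; its range is the graph of \<open>Z\<close> over
  range \<open>P\<close>. Since \<open>K K^T = 1 + Z^T Z\<close> there, this is the origin of the
  block \<open>A\<close>. \<open>S\<close> and \<open>K\<close> have the same kernel, and after the
  shears have been applied in all modes the condition with \<open>K\<close> becomes the one with
  \<open>P\<close>, because the shears of the other modes are invertible and can be stripped. The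
  encoding adds a second task: matrices have the full size of \<open>'n\<close>, but must stay
  supported on \<open>I k\<close>. The complement \<open>1 - P\<close> in the charts is taken in the
  full space, the one used to count dimensions inside the coordinate space of
  \<open>I k\<close>.\<close>

lemma Ck_on_cong: "Ck_on k E S f \<Longrightarrow> (\<And>x. x \<in> S \<Longrightarrow> f x = g x) \<Longrightarrow> Ck_on k E S g"
proof (cases k)
  case 0
  then show "Ck_on k E S f \<Longrightarrow> (\<And>x. x \<in> S \<Longrightarrow> f x = g x) \<Longrightarrow> Ck_on k E S g"
    by (simp cong: continuous_on_cong)
next
  case (Suc m)
  assume "Ck_on k E S f" and eq: "\<And>x. x \<in> S \<Longrightarrow> f x = g x"
  then obtain f' where "\<forall>x\<in>S. (f has_derivative f' x) (at x within S)" "\<forall>v\<in>E. Ck_on m E S (\<lambda>x. f' x v)"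
    unfolding Suc Ck_on.simps by blast
  then show "Ck_on k E S g"
    unfolding Suc Ck_on.simps using eq
    by (intro exI[of _ f'] conjI ballI) (auto intro: has_derivative_transform[where f = f])
qed

lemma Ck_on_Suc_imp: "Ck_on (Suc k) E S f \<Longrightarrow> Ck_on k E S f"
proof (induction k arbitrary: f)
  case 0
  then show ?case
    unfolding Ck_on.simps by (blast intro: has_derivative_continuous_on)
next
  case (Suc k)
  then show ?case
    unfolding Ck_on.simps(2)[of "Suc k"] Ck_on.simps(2)[of k] by blast
qed

lemma Ck_on_const [intro]: "Ck_on k E S (\<lambda>x. c)"
proof (induction k arbitrary: c)
  case (Suc k)
  then show ?case
    by (auto intro!: exI[of _ "\<lambda>_ _. 0"])
qed auto

lemma Ck_on_bounded_linear: "bounded_linear h \<Longrightarrow> Ck_on k E S f \<Longrightarrow> Ck_on k E S (\<lambda>x. h (f x))"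
proof (induction k arbitrary: f)
  case 0
  then show ?case by (auto intro: bounded_linear.continuous_on)
next
  case (Suc k)
  then obtain f' where f': "\<And>x. x \<in> S \<Longrightarrow> (f has_derivative f' x) (at x within S)"
    "\<And>v. v \<in> E \<Longrightarrow> Ck_on k E S (\<lambda>x. f' x v)"
    by auto
  then show ?case
    using Suc.IH[OF Suc.prems(1)] unfolding Ck_on.simps
    by (intro exI[of _ "\<lambda>x v. h (f' x v)"] conjI ballI
        bounded_linear.has_derivative[OF Suc.prems(1)]) blast+
qed

lemma Ck_on_id: "Ck_on k E S (\<lambda>x. x)"
proof (cases k)
  case (Suc m)
  then show ?thesis
    by (auto intro!: exI[of _ "\<lambda>x v. v"] Ck_on_const)
qed auto

lemma Ck_on_add: "Ck_on k E S f \<Longrightarrow> Ck_on k E S g \<Longrightarrow> Ck_on k E S (\<lambda>x. f x + g x)"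
proof (induction k arbitrary: f g)
  case 0
  then show ?case by (auto intro: continuous_on_add)
next
  case (Suc k)
  from Suc.prems obtain f' g' where "\<And>x. x \<in> S \<Longrightarrow> (f has_derivative f' x) (at x within S)"
    "\<And>v. v \<in> E \<Longrightarrow> Ck_on k E S (\<lambda>x. f' x v)"
    "\<And>x. x \<in> S \<Longrightarrow> (g has_derivative g' x) (at x within S)"
    "\<And>v. v \<in> E \<Longrightarrow> Ck_on k E S (\<lambda>x. g' x v)"
    unfolding Ck_on.simps by blast
  then show ?case
    using Suc.IH unfolding Ck_on.simps
    by (intro exI[of _ "\<lambda>x v. f' x v + g' x v"] conjI ballI has_derivative_add) blast+
qed

text \<open>The product rule keeps the undifferentiated factors \<open>f\<close> and
  \<open>g\<close>; they enter the induction hypothesis after \<open>Ck_on_Suc_imp\<close> has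
  lowered their class.\<close>

lemma Ck_on_bilinear:
  assumes h: "bounded_bilinear h"
  shows "Ck_on k E S f \<Longrightarrow> Ck_on k E S g \<Longrightarrow> Ck_on k E S (\<lambda>x. h (f x) (g x))"
proof (induction k arbitrary: f g)
  case 0
  then show ?case using h by (auto intro: bounded_bilinear.continuous_on)
next
  case (Suc k)
  from Suc.prems obtain f' g' where *: "\<And>x. x \<in> S \<Longrightarrow> (f has_derivative f' x) (at x within S)"
    "\<And>v. v \<in> E \<Longrightarrow> Ck_on k E S (\<lambda>x. f' x v)"
    "\<And>x. x \<in> S \<Longrightarrow> (g has_derivative g' x) (at x within S)"
    "\<And>v. v \<in> E \<Longrightarrow> Ck_on k E S (\<lambda>x. g' x v)"
    unfolding Ck_on.simps by blast
  show ?case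
    unfolding Ck_on.simps
  proof (intro exI[of _ "\<lambda>x v. h (f x) (g' x v) + h (f' x v) (g x)"] conjI ballI)
    fix x assume "x \<in> S"
    then show "((\<lambda>x. h (f x) (g x)) has_derivative (\<lambda>v. h (f x) (g' x v) + h (f' x v) (g x)))
        (at x within S)"
      using * by (intro bounded_bilinear.FDERIV[OF h]) auto
  next
    fix v assume "v \<in> E"
    then show "Ck_on k E S (\<lambda>x. h (f x) (g' x v) + h (f' x v) (g x))"
      using * Suc.IH Suc.prems[THEN Ck_on_Suc_imp] by (intro Ck_on_add) auto
  qed
qed

text \<open>The derivative of \<open>1 / f\<close> contains \<open>1 / f\<close> again, so the
  induction hypothesis, one class lower, is what handles the derivative.\<close>

lemma Ck_on_inverse:
  fixes f :: "'a::euclidean_space \<Rightarrow> real"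
  assumes nz: "\<And>x. x \<in> S \<Longrightarrow> f x \<noteq> 0"
  shows "Ck_on k E S f \<Longrightarrow> Ck_on k E S (\<lambda>x. inverse (f x))"
proof (induction k)
  case 0
  then show ?case using nz by (auto intro!: continuous_intros)
next
  case (Suc k)
  then obtain f' where *: "\<And>x. x \<in> S \<Longrightarrow> (f has_derivative f' x) (at x within S)"
    "\<And>v. v \<in> E \<Longrightarrow> Ck_on k E S (\<lambda>x. f' x v)"
    by auto
  note mult = Ck_on_bilinear[OF bounded_bilinear_mult]
  have inv: "Ck_on k E S (\<lambda>x. inverse (f x))"
    using Suc Ck_on_Suc_imp by blast
  show ?case
    unfolding Ck_on.simps
  proof (intro exI[of _ "\<lambda>x v. - (inverse (f x) * f' x v * inverse (f x))"] conjI ballI)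
    fix x assume "x \<in> S"
    then show "((\<lambda>x. inverse (f x)) has_derivative (\<lambda>v. - (inverse (f x) * f' x v * inverse (f x))))
        (at x within S)"
      using * nz by (intro Deriv.has_derivative_inverse) auto
  next
    fix v assume "v \<in> E"
    then show "Ck_on k E S (\<lambda>x. - (inverse (f x) * f' x v * inverse (f x)))"
      by (intro Ck_on_bounded_linear[OF bounded_linear_minus[OF bounded_linear_ident]] mult inv *)
  qed
qed

named_theorems smooth_intros

lemma smooth_on_cong: "smooth_on E S f \<Longrightarrow> (\<And>x. x \<in> S \<Longrightarrow> f x = g x) \<Longrightarrow> smooth_on E S g"
  unfolding smooth_on_def using Ck_on_cong by blast

lemma smooth_on_imp_continuous_on: "smooth_on E S f \<Longrightarrow> continuous_on S f"
  unfolding smooth_on_def by (metis Ck_on.simps(1))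

lemma smooth_on_const [smooth_intros]: "smooth_on E S (\<lambda>x. c)"
  by (auto simp: smooth_on_def)

lemma smooth_on_bounded_linear: "bounded_linear h \<Longrightarrow> smooth_on E S f \<Longrightarrow> smooth_on E S (\<lambda>x. h (f x))"
  by (auto simp: smooth_on_def intro: Ck_on_bounded_linear)

lemma smooth_on_linear:
  fixes h :: "'a::euclidean_space \<Rightarrow> 'b::real_normed_vector"
  shows "linear h \<Longrightarrow> smooth_on E S f \<Longrightarrow> smooth_on E S (\<lambda>x. h (f x))"
  by (rule smooth_on_bounded_linear[OF linear_conv_bounded_linear[THEN iffD1]])

lemma smooth_on_id [smooth_intros]: "smooth_on E S (\<lambda>x. x)"
  by (auto simp: smooth_on_def intro: Ck_on_id)

lemma smooth_on_add [smooth_intros]: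
  "smooth_on E S f \<Longrightarrow> smooth_on E S g \<Longrightarrow> smooth_on E S (\<lambda>x. f x + g x)"
  by (auto simp: smooth_on_def intro: Ck_on_add)

lemma smooth_on_minus [smooth_intros]: "smooth_on E S f \<Longrightarrow> smooth_on E S (\<lambda>x. - f x)"
  by (rule smooth_on_bounded_linear[OF bounded_linear_minus[OF bounded_linear_ident]])

lemma smooth_on_diff [smooth_intros]:
  "smooth_on E S f \<Longrightarrow> smooth_on E S g \<Longrightarrow> smooth_on E S (\<lambda>x. f x - g x)"
  using smooth_on_add[OF _ smooth_on_minus] by fastforce

lemma smooth_on_bilinear:
  "bounded_bilinear h \<Longrightarrow> smooth_on E S f \<Longrightarrow> smooth_on E S g \<Longrightarrow> smooth_on E S (\<lambda>x. h (f x) (g x))"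
  by (auto simp: smooth_on_def intro: Ck_on_bilinear)

lemma smooth_on_inverse [smooth_intros]:
  fixes f :: "'a::euclidean_space \<Rightarrow> real"
  shows "smooth_on E S f \<Longrightarrow> (\<And>x. x \<in> S \<Longrightarrow> f x \<noteq> 0) \<Longrightarrow> smooth_on E S (\<lambda>x. inverse (f x))"
  by (auto simp: smooth_on_def intro: Ck_on_inverse)

lemma smooth_on_mult [smooth_intros]:
  fixes f :: "'a::euclidean_space \<Rightarrow> real"
  shows "smooth_on E S f \<Longrightarrow> smooth_on E S g \<Longrightarrow> smooth_on E S (\<lambda>x. f x * g x)"
  by (rule smooth_on_bilinear[OF bounded_bilinear_mult])

lemma smooth_on_sum [smooth_intros]:
  "(\<And>i. i \<in> I \<Longrightarrow> smooth_on E S (f i)) \<Longrightarrow> smooth_on E S (\<lambda>x. \<Sum>i\<in>I. f i x)"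
  by (induction I rule: infinite_finite_induct) (auto intro: smooth_intros)

lemma smooth_on_prod [smooth_intros]:
  fixes f :: "'i \<Rightarrow> 'a::euclidean_space \<Rightarrow> real"
  shows "(\<And>i. i \<in> I \<Longrightarrow> smooth_on E S (f i)) \<Longrightarrow> smooth_on E S (\<lambda>x. \<Prod>i\<in>I. f i x)"
  by (induction I rule: infinite_finite_induct) (auto intro: smooth_intros)

lemma smooth_on_fst [smooth_intros]: "smooth_on E S f \<Longrightarrow> smooth_on E S (\<lambda>x. fst (f x))"
  by (rule smooth_on_bounded_linear[OF bounded_linear_fst])

lemma smooth_on_snd [smooth_intros]: "smooth_on E S f \<Longrightarrow> smooth_on E S (\<lambda>x. snd (f x))"
  by (rule smooth_on_bounded_linear[OF bounded_linear_snd])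

lemma smooth_on_nth [smooth_intros]: "smooth_on E S f \<Longrightarrow> smooth_on E S (\<lambda>x. f x $ i)"
  by (rule smooth_on_bounded_linear[OF bounded_linear_vec_nth])

lemma smooth_on_Pair [smooth_intros]:
  assumes "smooth_on E S f" "smooth_on E S g"
  shows "smooth_on E S (\<lambda>x. (f x, g x))"
proof -
  have "smooth_on E S (\<lambda>x. (f x, 0) + (0, g x))"
    by (intro smooth_on_add
        smooth_on_bounded_linear[OF bounded_linear_Pair[OF bounded_linear_ident bounded_linear_zero]]
        smooth_on_bounded_linear[OF bounded_linear_Pair[OF bounded_linear_zero bounded_linear_ident]]
        assms)
  then show ?thesis by simp
qed

text \<open>A vector is the sum of its components placed by the linear maps \<open>axis i\<close>,
  which reduces the claim to linear maps and finite sums.\<close>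

lemma smooth_on_vec_lambda [smooth_intros]:
  fixes f :: "'i::finite \<Rightarrow> 'a::euclidean_space \<Rightarrow> 'b::euclidean_space"
  assumes "\<And>i. smooth_on E S (f i)"
  shows "smooth_on E S (\<lambda>x. \<chi> i. f i x)"
proof -
  have "linear (axis i :: 'b \<Rightarrow> _)" for i :: 'i
    by (rule linearI) (auto simp: axis_def vec_eq_iff)
  then have "smooth_on E S (\<lambda>x. \<Sum>i\<in>UNIV. axis i (f i x))"
    by (intro smooth_on_sum smooth_on_linear[OF _ assms])
  also have "(\<lambda>x. \<Sum>i\<in>UNIV. axis i (f i x)) = (\<lambda>x. \<chi> i. f i x)"
    by (auto simp: axis_def vec_eq_iff sum_component if_distrib cong: if_cong)
  finally show ?thesis .
qed

lemma smooth_on_matrix_mult [smooth_intros]: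
  fixes A B :: "'a::euclidean_space \<Rightarrow> real ^ 'n ^ 'n"
  shows "smooth_on E S A \<Longrightarrow> smooth_on E S B \<Longrightarrow> smooth_on E S (\<lambda>x. A x ** B x)"
  unfolding matrix_matrix_mult_def by (intro smooth_intros)

lemma smooth_on_transpose [smooth_intros]:
  fixes A :: "'a::euclidean_space \<Rightarrow> real ^ 'n ^ 'n"
  shows "smooth_on E S A \<Longrightarrow> smooth_on E S (\<lambda>x. transpose (A x))"
  unfolding transpose_def by (intro smooth_intros)

lemma smooth_on_det [smooth_intros]:
  fixes A :: "'a::euclidean_space \<Rightarrow> real ^ 'n ^ 'n"
  shows "smooth_on E S A \<Longrightarrow> smooth_on E S (\<lambda>x. det (A x))"
  unfolding det_def by (intro smooth_intros)

section \<open>Smooth dependence of the matrix inverse\<close>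

lemma matrix_inv_right:
  fixes A :: "real ^ 'n ^ 'n"
  shows "invertible A \<Longrightarrow> A ** matrix_inv A = mat 1"
  unfolding invertible_def matrix_inv_def by (rule someI2_ex) auto

lemma matrix_inv_left:
  fixes A :: "real ^ 'n ^ 'n"
  shows "invertible A \<Longrightarrow> matrix_inv A ** A = mat 1"
  unfolding invertible_def matrix_inv_def by (rule someI2_ex) auto

text \<open>Writes each entry of the inverse as a polynomial in the entries times one reciprocal, so
  that smoothness of inversion follows from \<open>smooth_on_det\<close> and
  \<open>smooth_on_inverse\<close>.\<close>

lemma matrix_inv_Cramer:
  fixes A :: "real ^ 'n ^ 'n"
  assumes "det A \<noteq> 0"
  shows "matrix_inv A = (\<chi> i j. det (\<chi> a b. if b = i then axis j 1 $ a else A $ a $ b) * inverse (det A))"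
proof -
  have "invertible A"
    using assms by (simp add: invertible_det_nz)
  then have "A *v (matrix_inv A *v axis j 1) = axis j 1" for j
    by (simp add: matrix_vector_mul_assoc matrix_inv_right)
  then have "matrix_inv A *v axis j 1 = (\<chi> i. det (\<chi> a b. if b = i then axis j 1 $ a else A $ a $ b) / det A)" for j
    using cramer[OF assms] by blast
  then show ?thesis
    by (simp add: vec_eq_iff matrix_vector_mul_component divide_inverse cart_eq_inner_axis[of "matrix_inv A $ _"])
qed

lemma smooth_on_matrix_inv [smooth_intros]:
  fixes A :: "'a::euclidean_space \<Rightarrow> real ^ 'n ^ 'n"
  assumes A: "smooth_on E S A" and nz: "\<And>x. x \<in> S \<Longrightarrow> det (A x) \<noteq> 0"
  shows "smooth_on E S (\<lambda>x. matrix_inv (A x))"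
proof -
  have "smooth_on E S (\<lambda>x. if b = i then axis j 1 $ a else A x $ a $ b)" for a b i j
    using A by (cases "b = i") (auto intro: smooth_intros)
  then have "smooth_on E S (\<lambda>x. \<chi> i j. det (\<chi> a b. if b = i then axis j 1 $ a else A x $ a $ b)
      * inverse (det (A x)))"
    using A nz by (intro smooth_intros) auto
  then show ?thesis
    by (rule smooth_on_cong) (simp add: matrix_inv_Cramer nz)
qed

section \<open>Orthogonal projections and their traces\<close>

text \<open>Parseval: expanding \<open>f b\<close> in an orthonormal basis of the range and swapping
  the sums turns the trace into the sum of the squared norms of the basis vectors. Every dimension
  below is obtained as such a trace.\<close>

lemma dim_range_orthogonal_projection:
  fixes f :: "'a::euclidean_space \<Rightarrow> 'a"
  assumes "linear f" and idem: "\<And>x. f (f x) = f x" and adj: "\<And>x y. f x \<bullet> y = x \<bullet> f y"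
  shows "real (dim (range f)) = (\<Sum>b\<in>Basis. f b \<bullet> b)"
proof -
  have "subspace (range f)"
    using assms(1) linear_subspace_image subspace_UNIV by blast
  then obtain B where B: "B \<subseteq> range f" "pairwise orthogonal B" "\<And>x. x \<in> B \<Longrightarrow> norm x = 1"
    "independent B" "card B = dim (range f)" "span B = range f"
    using orthonormal_basis_subspace by metis
  have "finite B"
    using B(4) finiteI_independent by blast
  have fix_B: "f u = u" if "u \<in> B" for u
    using that B(1) idem by auto
  have "f b \<bullet> b = (\<Sum>u\<in>B. (u \<bullet> b) * (u \<bullet> b))" for b
  proof -
    have "f b = (\<Sum>u\<in>B. (f b \<bullet> u) *\<^sub>R u)"
      using orthonormal_basis_expand[OF B(2,3) _ \<open>finite B\<close>, of "f b"] B(6) by simp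
    also have "\<dots> = (\<Sum>u\<in>B. (u \<bullet> b) *\<^sub>R u)"
      using adj[of b] by (intro sum.cong) (simp_all add: fix_B inner_commute)
    finally show ?thesis
      by (simp add: inner_sum_left)
  qed
  then have "(\<Sum>b\<in>Basis. f b \<bullet> b) = (\<Sum>u\<in>B. \<Sum>b\<in>Basis. (u \<bullet> b) * (u \<bullet> b))"
    by (simp add: sum.swap[of _ _ Basis])
  also have "\<dots> = (\<Sum>u\<in>B. 1)"
    using B(3) by (intro sum.cong) (auto simp: euclidean_inner[symmetric] norm_eq_1)
  finally show ?thesis
    using B(5) by simp
qed

lemma sum_Basis_vec:
  "(\<Sum>b\<in>Basis. f (b :: 'a::euclidean_space ^ 'n)) = (\<Sum>i\<in>UNIV. \<Sum>u\<in>Basis. f (axis i u))"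
proof -
  have inj: "inj_on (\<lambda>(i :: 'n, u :: 'a). axis i u) (UNIV \<times> Basis)"
    by (auto simp: inj_on_def axis_eq_axis)
  have "(Basis :: ('a ^ 'n) set) = (\<lambda>(i, u). axis i u) ` (UNIV \<times> Basis)"
    by (auto simp: Basis_vec_def)
  then have "sum f Basis = sum f ((\<lambda>(i, u). axis i u) ` (UNIV \<times> Basis))"
    by (rule arg_cong)
  then show ?thesis
    by (simp only: sum.reindex[OF inj] sum.cartesian_product) (simp add: case_prod_unfold)
qed

text \<open>Acting componentwise, the \<open>f k\<close> form one orthogonal projection, and its
  trace is the sum of theirs.\<close>

lemma dim_vec_range_orthogonal_projection:
  fixes f :: "'n::finite \<Rightarrow> 'a::euclidean_space \<Rightarrow> 'a"
  assumes lin: "\<And>k. linear (f k)" and idem: "\<And>k x. f k (f k x) = f k x"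
    and adj: "\<And>k x y. f k x \<bullet> y = x \<bullet> f k y"
  shows "dim {T :: 'a ^ 'n. \<forall>k. T $ k \<in> range (f k)} = (\<Sum>k\<in>UNIV. dim (range (f k)))"
proof -
  define F :: "'a ^ 'n \<Rightarrow> 'a ^ 'n" where "F T = (\<chi> k. f k (T $ k))" for T
  have F: "linear F" "F (F T) = F T" "F T \<bullet> U = T \<bullet> F U" for T U
    using linear_add[OF lin] linear_scale[OF lin]
    by (auto intro!: linearI simp: F_def vec_eq_iff idem inner_vec_def adj)
  have "T \<in> range F" if "\<forall>k. T $ k \<in> range (f k)" for T
  proof -
    have "f k (T $ k) = T $ k" for k
    proof -
      from that have "T $ k \<in> range (f k)" by simp
      then obtain y where "T $ k = f k y" by (rule rangeE)
      then show ?thesis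
        by (simp add: idem)
    qed
    then have "T = F T"
      by (simp add: F_def vec_eq_iff)
    then show ?thesis by blast
  qed
  then have "{T. \<forall>k. T $ k \<in> range (f k)} = range F"
    by (auto simp: F_def)
  moreover have "real (dim (range F)) = (\<Sum>k\<in>UNIV. real (dim (range (f k))))"
    unfolding dim_range_orthogonal_projection[OF F] dim_range_orthogonal_projection[OF lin idem adj]
      sum_Basis_vec
    by (simp add: F_def inner_axis)
  ultimately have "real (dim {T :: 'a ^ 'n. \<forall>k. T $ k \<in> range (f k)}) = real (\<Sum>k\<in>UNIV. dim (range (f k)))"
    by simp
  then show ?thesis
    by (simp only: of_nat_eq_iff)
qed

lemma rank_eq_trace:
  fixes P :: "real ^ 'n ^ 'n"
  assumes sym: "transpose P = P" and idem: "P ** P = P"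
  shows "real (rank P) = trace P"
proof -
  have "(P *v x) \<bullet> y = x \<bullet> (P *v y)" for x y
    using sym by (metis dot_lmul_matrix transpose_matrix_vector)
  then have "real (rank P) = (\<Sum>b\<in>Basis. (P *v b) \<bullet> b)"
    unfolding rank_dim_range
    by (intro dim_range_orthogonal_projection) (auto simp: matrix_vector_mul_assoc idem)
  also have "\<dots> = trace P"
    by (simp add: sum_Basis_vec trace_def matrix_vector_mul_component
        flip: cart_eq_inner_axis)
  finally show ?thesis .
qed

section \<open>Multilinear multiplication\<close>

text \<open>The simultaneous product \<open>X x_1 G_1 ... x_d G_d\<close>, that is, the Kronecker
  product of the \<open>G k\<close> applied to \<open>X\<close>. A single weight for all modes
  avoids ordering them.\<close>

definition multi_prod ::
    "('d::finite \<Rightarrow> real ^ 'n ^ 'n) \<Rightarrow> real ^ ('d \<Rightarrow> 'n::finite) \<Rightarrow> real ^ ('d \<Rightarrow> 'n)"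
  where "multi_prod G X = (\<chi> i. \<Sum>j\<in>UNIV. (\<Prod>k\<in>UNIV. G k $ i k $ j k) * X $ j)"

lemma prod_sum_UNIV:
  fixes f :: "'d::finite \<Rightarrow> 'n::finite \<Rightarrow> real"
  shows "(\<Prod>k\<in>UNIV. \<Sum>l\<in>UNIV. f k l) = (\<Sum>j\<in>UNIV. \<Prod>k\<in>UNIV. f k (j k))"
  using prod_sum_PiE[of "UNIV :: 'd set" "\<lambda>_. UNIV :: 'n set" f] by (simp add: PiE_UNIV_domain)

lemma linear_multi_prod: "linear (multi_prod G)"
  by (rule linearI)
     (auto simp: multi_prod_def vec_eq_iff algebra_simps sum.distrib sum_distrib_left)

text \<open>The sum over the intermediate multi-index factors mode by mode, by
  \<open>prod_sum_UNIV\<close>.\<close>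

lemma multi_prod_multi_prod: "multi_prod G (multi_prod H X) = multi_prod (\<lambda>k. G k ** H k) X"
proof -
  have "multi_prod G (multi_prod H X) $ i = multi_prod (\<lambda>k. G k ** H k) X $ i" for i
  proof -
    have "multi_prod G (multi_prod H X) $ i
        = (\<Sum>j\<in>UNIV. \<Sum>m\<in>UNIV. (\<Prod>k\<in>UNIV. G k $ i k $ j k * H k $ j k $ m k) * X $ m)"
      by (simp add: multi_prod_def sum_distrib_left prod.distrib mult.assoc)
    also have "\<dots> = (\<Sum>m\<in>UNIV. (\<Sum>j\<in>UNIV. \<Prod>k\<in>UNIV. G k $ i k $ j k * H k $ j k $ m k) * X $ m)"
      by (subst sum.swap) (simp add: sum_distrib_right)
    also have "\<dots> = multi_prod (\<lambda>k. G k ** H k) X $ i"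
      by (simp only: multi_prod_def matrix_matrix_mult_def vec_lambda_beta prod_sum_UNIV)
    finally show ?thesis .
  qed
  then show ?thesis
    by (simp add: vec_eq_iff)
qed

text \<open>With identities in the other modes, the weight vanishes unless \<open>j\<close> agrees
  with \<open>i\<close> away from \<open>k\<close>. Through this embedding the composition rules for
  \<open>mode_prod\<close> are inherited from \<open>multi_prod_multi_prod\<close>.\<close>

lemma mode_prod_eq_multi_prod: "mode_prod X k A = multi_prod ((\<lambda>_. mat 1)(k := A)) X"
proof -
  have "mode_prod X k A $ i = multi_prod ((\<lambda>_. mat 1)(k := A)) X $ i" for i
  proof -
    let ?w = "\<lambda>j. \<Prod>m\<in>UNIV. ((\<lambda>_. mat 1)(k := A)) m $ i m $ j m"
    have zero: "?w j = 0" if "j \<notin> range (\<lambda>l. i(k := l))" for j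
    proof -
      have "j \<noteq> i(k := j k)"
        using that by blast
      then obtain m where "m \<noteq> k" "i m \<noteq> j m"
        by (auto simp: fun_eq_iff split: if_splits)
      then show ?thesis
        by (intro prod_zero bexI[of _ m]) (auto simp: mat_def)
    qed
    have w: "?w (i(k := l)) = A $ i k $ l" for l
    proof -
      have "?w (i(k := l)) = A $ i k $ l * (\<Prod>m\<in>UNIV - {k}. 1)"
        by (subst prod.remove[of _ k]) (auto simp: mat_def intro!: prod.cong)
      then show ?thesis by simp
    qed
    have inj: "inj (\<lambda>l. i(k := l))"
      by (metis fun_upd_same injI)
    have "multi_prod ((\<lambda>_. mat 1)(k := A)) X $ i = (\<Sum>j\<in>UNIV. ?w j * X $ j)"
      by (simp only: multi_prod_def vec_lambda_beta)
    also have "\<dots> = (\<Sum>j\<in>range (\<lambda>l. i(k := l)). ?w j * X $ j)"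
      using zero by (intro sum.mono_neutral_right) auto
    also have "\<dots> = (\<Sum>l\<in>UNIV. A $ i k $ l * X $ (i(k := l)))"
      by (subst sum.reindex[OF inj]) (simp only: o_def w)
    also have "\<dots> = mode_prod X k A $ i"
      by (simp add: mode_prod_def)
    finally show ?thesis by simp
  qed
  then show ?thesis
    by (simp add: vec_eq_iff)
qed

lemma mode_prod_mat_1 [simp]: "mode_prod X k (mat 1) = X"
  by (simp add: mode_prod_def mat_def vec_eq_iff if_distrib[where f = "\<lambda>c. c * _"] sum.delta' cong: if_cong)

lemma multi_prod_mat_1 [simp]: "multi_prod (\<lambda>_. mat 1) X = X"
  \<comment> \<open>Any mode serves here, since replacing an identity by an identity changes
    nothing; \<open>undefined\<close> names one.\<close>
  using mode_prod_eq_multi_prod[of X undefined "mat 1"] by (simp add: fun_upd_idem)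

lemma mode_prod_multi_prod: "mode_prod (multi_prod G X) k A = multi_prod (G(k := A ** G k)) X"
  unfolding mode_prod_eq_multi_prod multi_prod_multi_prod
  by (rule arg_cong[of _ _ "\<lambda>G. multi_prod G X"]) auto

lemma multi_prod_mode_prod: "multi_prod G (mode_prod X k A) = multi_prod (G(k := G k ** A)) X"
  unfolding mode_prod_eq_multi_prod multi_prod_multi_prod
  by (rule arg_cong[of _ _ "\<lambda>G. multi_prod G X"]) auto

lemma mode_prod_mode_prod: "mode_prod (mode_prod X k A) k B = mode_prod X k (B ** A)"
  unfolding mode_prod_eq_multi_prod[of X] by (simp add: mode_prod_multi_prod)

lemma mode_prod_0 [simp]: "mode_prod 0 k A = 0" "mode_prod X k 0 = 0"
  by (simp_all add: mode_prod_def vec_eq_iff)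

lemma mode_prod_diff: "mode_prod X k (A - B) = mode_prod X k A - mode_prod X k B"
  by (simp add: mode_prod_def vec_eq_iff algebra_simps sum_subtractf)

lemma linear_mode_prod: "linear (\<lambda>X. mode_prod X k A)"
  unfolding mode_prod_eq_multi_prod by (rule linear_multi_prod)

lemma multi_prod_eq_0:
  assumes "G k = 0"
  shows "multi_prod G X = 0"
proof -
  have "(\<Prod>m\<in>UNIV. G m $ i m $ j m) = 0" for i j
    using assms by (intro prod_zero bexI[of _ k]) auto
  then show ?thesis
    unfolding multi_prod_def by (simp only: mult_zero_left sum.neutral_const) (simp add: vec_eq_iff)
qed

text \<open>Induction on the set \<open>K\<close> of modes in which the identity has already been
  replaced by \<open>G k\<close>.\<close>

lemma multi_prod_eq_self:
  assumes "\<And>k. mode_prod X k (G k) = X"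
  shows "multi_prod G X = X"
proof -
  have "multi_prod (\<lambda>k. if k \<in> K then G k else mat 1) X = X" if "finite K" for K
    using that
  proof (induction K)
    case (insert k K)
    let ?G = "\<lambda>k. if k \<in> K then G k else mat 1"
    have "multi_prod (\<lambda>m. if m \<in> insert k K then G m else mat 1) X
        = mode_prod (multi_prod ?G X) k (G k)"
      unfolding mode_prod_multi_prod using insert.hyps
      by (intro arg_cong[of _ _ "\<lambda>G. multi_prod G X"]) auto
    then show ?case
      using insert.IH assms by simp
  qed simp
  from this[of UNIV] show ?thesis by simp
qed

lemma inner_multi_prod: "multi_prod G X \<bullet> Y = X \<bullet> multi_prod (\<lambda>k. transpose (G k)) Y"
proof -
  have "multi_prod G X \<bullet> Y = (\<Sum>i\<in>UNIV. \<Sum>j\<in>UNIV. (\<Prod>k\<in>UNIV. G k $ i k $ j k) * X $ j * Y $ i)"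
    by (simp add: multi_prod_def inner_vec_def sum_distrib_right)
  also have "\<dots> = (\<Sum>j\<in>UNIV. \<Sum>i\<in>UNIV. (\<Prod>k\<in>UNIV. G k $ i k $ j k) * X $ j * Y $ i)"
    by (rule sum.swap)
  also have "\<dots> = X \<bullet> multi_prod (\<lambda>k. transpose (G k)) Y"
    by (simp add: multi_prod_def inner_vec_def sum_distrib_left transpose_def algebra_simps)
  finally show ?thesis .
qed

text \<open>Diagonal entries of a Kronecker product multiply, and their sum over multi-indices
  factors into one sum per mode.\<close>

lemma trace_multi_prod: "(\<Sum>b\<in>Basis. multi_prod G b \<bullet> b) = (\<Prod>k\<in>UNIV. trace (G k))"
proof -
  have "multi_prod G (axis i 1) $ i = (\<Prod>k\<in>UNIV. G k $ i k $ i k)" for i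
    by (simp add: multi_prod_def axis_def if_distrib[where f = "\<lambda>c. _ * c"] sum.delta' cong: if_cong)
  then show ?thesis
    by (simp add: trace_def prod_sum_UNIV sum_Basis_vec inner_axis)
qed

section \<open>A slice chart for the symmetric projections\<close>

lemma matrix_diff_ldistrib: "A ** (B - C) = A ** B - A ** C" for A :: "real ^ 'n ^ 'm"
  by (vector matrix_matrix_mult_def sum_subtractf[symmetric] field_simps)

lemma matrix_diff_rdistrib: "(A - B) ** C = A ** C - B ** C" for A :: "real ^ 'n ^ 'm"
  by (vector matrix_matrix_mult_def sum_subtractf[symmetric] field_simps)

lemma matrix_add_rdistrib: "(A + B) ** C = A ** C + B ** C" for A :: "real ^ 'n ^ 'm"
  by (vector matrix_matrix_mult_def sum.distrib[symmetric] field_simps)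

lemma transpose_add: "transpose (A + B) = transpose A + transpose B"
  by (simp add: transpose_def vec_eq_iff)

lemma transpose_0 [simp]: "transpose 0 = 0"
  by (simp add: transpose_def vec_eq_iff)

lemma transpose_diff: "transpose (A - B) = transpose A - transpose B"
  by (simp add: transpose_def vec_eq_iff)

lemma transpose_matrix_inv:
  fixes A :: "real ^ 'n ^ 'n"
  assumes "invertible A"
  shows "transpose (matrix_inv A) = matrix_inv (transpose A)"
proof -
  have "invertible (transpose A)"
    using assms by (rule transpose_invertible)
  moreover have "transpose A ** transpose (matrix_inv A) = mat 1"
    using assms by (simp add: matrix_inv_left flip: matrix_transpose_mul)
  ultimately show ?thesis
    by (metis matrix_inv_left matrix_mul_assoc matrix_mul_lid matrix_mul_rid)
qed

lemma matrix_inv_commute: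
  fixes A B :: "real ^ 'n ^ 'n"
  assumes "invertible A" "A ** B = B ** A"
  shows "matrix_inv A ** B = B ** matrix_inv A"
proof -
  have "matrix_inv A ** (A ** B) ** matrix_inv A = matrix_inv A ** (B ** A) ** matrix_inv A"
    using assms(2) by simp
  then have "(matrix_inv A ** A) ** (B ** matrix_inv A) = (matrix_inv A ** B) ** (A ** matrix_inv A)"
    by (simp only: matrix_mul_assoc)
  then show ?thesis
    using assms(1) by (simp add: matrix_inv_left matrix_inv_right)
qed

text \<open>Positive definiteness, for every \<open>N\<close>. This is why \<open>gram\<close>, and
  with it \<open>Gr_unchart\<close>, is smooth without restricting the domain.\<close>

lemma invertible_mat_1_plus_gram:
  fixes N :: "real ^ 'n ^ 'n"
  shows "invertible (mat 1 + N ** transpose N)"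
proof -
  have "x = 0" if "(mat 1 + N ** transpose N) *v x = 0" for x
  proof -
    have "x \<bullet> x + (transpose N *v x) \<bullet> (transpose N *v x)
        = x \<bullet> ((mat 1 + N ** transpose N) *v x)"
      by (simp add: matrix_vector_mult_add_rdistrib inner_add_right dot_lmul_matrix
          flip: matrix_vector_mul_assoc)
    then have "x \<bullet> x + (transpose N *v x) \<bullet> (transpose N *v x) = 0"
      using that by simp
    then show ?thesis
      by (metis add_nonneg_eq_0_iff inner_eq_zero_iff inner_ge_zero)
  qed
  then show ?thesis
    by (simp add: invertible_left_inverse matrix_left_invertible_ker)
qed

text \<open>
  In the block notation above, \<open>slope P S\<close> is \<open>[[0, Z\<^sup>T], [0, 0]]\<close>, computed from
  \<open>S = [[A, B], [B\<^sup>T, D]]\<close> as \<open>Z\<^sup>T = A\<^sup>-\<^sup>1 B\<close>. In \<open>corner\<close> the identity on \<open>ker P\<close> is added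
  only to make \<open>A\<close> invertible as a full-size matrix.
\<close>

definition corner :: "real ^ 'n ^ 'n \<Rightarrow> real ^ 'n ^ 'n \<Rightarrow> real ^ 'n ^ 'n"
  where "corner P S = P ** S ** P + (mat 1 - P)"

definition slope :: "real ^ 'n ^ 'n \<Rightarrow> real ^ 'n ^ 'n \<Rightarrow> real ^ 'n ^ 'n"
  where "slope P S = P ** matrix_inv (corner P S) ** S ** (mat 1 - P)"

text \<open>\<open>N N^T\<close> is \<open>Z^T Z\<close> on range \<open>P\<close> and zero on
  \<open>ker P\<close>, where the inverse is therefore the identity; the factor \<open>P\<close>
  removes that part and leaves \<open>(1 + Z^T Z)^-1\<close> extended by zero.\<close>

definition gram :: "real ^ 'n ^ 'n \<Rightarrow> real ^ 'n ^ 'n \<Rightarrow> real ^ 'n ^ 'n"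
  where "gram P N = P ** matrix_inv (mat 1 + N ** transpose N)"

text \<open>Packs the three slice coordinates into one symmetric matrix:
  \<open>A - (1 + Z^T Z)^-1\<close> and \<open>C\<close> in the diagonal blocks, \<open>N\<close>
  and its transpose in the mixed ones. The chart thus maps symmetric matrices to symmetric matrices,
  and the slice is where the diagonal blocks vanish.\<close>

definition Gr_chart :: "real ^ 'n ^ 'n \<Rightarrow> real ^ 'n ^ 'n \<Rightarrow> real ^ 'n ^ 'n"
  where "Gr_chart P S =
    (let N = slope P S in
      (mat 1 - transpose N) ** S ** (mat 1 - N) - gram P N + N + transpose N)"

definition Gr_unchart :: "real ^ 'n ^ 'n \<Rightarrow> real ^ 'n ^ 'n \<Rightarrow> real ^ 'n ^ 'n"
  where "Gr_unchart P T =
    (let E = mat 1 - P; N = P ** T ** E in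
      (mat 1 + transpose N) ** (P ** T ** P + E ** T ** E + gram P N) ** (mat 1 + N))"

locale base_projection =
  fixes P :: "real ^ 'n ^ 'n"
  assumes sym: "transpose P = P" and idem: "P ** P = P"
begin

definition E where "E = mat 1 - P"

text \<open>The second row repeats reductions behind an arbitrary left factor, as they occur once
  \<open>matrix_mul_assoc\<close> has associated products to the left.\<close>

lemma PE [simp]: "P ** P = P" "P ** E = 0" "E ** P = 0" "E ** E = E"
  "X ** P ** P = X ** P" "X ** P ** E = 0" "X ** E ** P = 0" "X ** E ** E = X ** E"
  by (simp_all add: E_def idem matrix_diff_ldistrib matrix_diff_rdistrib flip: matrix_mul_assoc)

lemma transpose_PE [simp]: "transpose P = P" "transpose E = E"
  by (simp_all add: E_def sym transpose_diff)

lemma add_PE: "X ** P + X ** E = X" "P ** X + E ** X = X"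
  by (simp_all add: E_def matrix_diff_ldistrib matrix_diff_rdistrib)

lemmas mat_expand = matrix_mul_assoc matrix_add_ldistrib matrix_add_rdistrib
  matrix_diff_ldistrib matrix_diff_rdistrib

end


text \<open>Derives, from any reduction of a product, the form that fires inside a longer
  left-associated product.\<close>

lemma matrix_mul_assoc_rule: "A ** B = C \<Longrightarrow> X ** A ** B = X ** C" for A :: "real ^ 'n ^ 'n"
  by (simp flip: matrix_mul_assoc)

text \<open>\<open>N\<close> kills range \<open>P\<close> and maps \<open>ker P\<close> into range
  \<open>P\<close>: it is a strictly upper triangular block. Hence \<open>N ** N = 0\<close>, and
  the shear \<open>1 + N\<close> has inverse \<open>1 - N\<close>.\<close>

locale base_projection_slope = base_projection P for P :: "real ^ 'n ^ 'n" +
  fixes N :: "real ^ 'n ^ 'n"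
  assumes PN: "P ** N = N" and NE: "N ** E = N"
begin

abbreviation "N' \<equiv> transpose N"

abbreviation "g \<equiv> gram P N"

lemma N_rules: "P ** N = N" "N ** E = N" "N ** P = 0" "E ** N = 0" "N ** N = 0"
  "N' ** P = N'" "E ** N' = N'" "P ** N' = 0" "N' ** E = 0" "N' ** N' = 0"
proof -
  show *: "P ** N = N" "N ** E = N" by (fact PN NE)+
  show NP: "N ** P = 0"
    by (metis * PE(7) times0_right)
  show EN: "E ** N = 0"
    by (metis * PE(3) matrix_mul_assoc times0_left)
  show NN: "N ** N = 0"
    by (metis * EN matrix_mul_assoc times0_right)
  have tr: "B ** A = C" if "transpose A ** transpose B = transpose C" for A B C :: "real ^ 'n ^ 'n"
    using that by (metis matrix_transpose_mul transpose_iff)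
  show "N' ** P = N'" "E ** N' = N'" "P ** N' = 0" "N' ** E = 0" "N' ** N' = 0"
    by (rule tr, simp add: * NP EN NN)+
qed

lemmas N_simps [simp] = N_rules N_rules[THEN matrix_mul_assoc_rule]

text \<open>\<open>1 + N N'\<close> commutes with \<open>P\<close> and compresses to
  \<open>P + N N'\<close>; its inverse, cut down by \<open>P\<close>, is therefore the inverse of
  \<open>P + N N'\<close> on range \<open>P\<close>.\<close>

lemma gram_rules: "P ** g = g" "g ** P = g" "E ** g = 0" "g ** E = 0" "transpose g = g"
  and gram_inverse: "g ** (P + N ** N') = P" "(P + N ** N') ** g = P"
proof -
  let ?M = "mat 1 + N ** N'"
  have M: "invertible ?M"
    by (rule invertible_mat_1_plus_gram)
  have PM: "?M ** P = P ** ?M" "P ** ?M = P + N ** N'"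
    by (simp_all add: mat_expand)
  have W: "matrix_inv ?M ** P = P ** matrix_inv ?M"
    using M PM by (intro matrix_inv_commute)
  show 1: "P ** g = g" "g ** P = g"
    by (simp_all add: gram_def W matrix_mul_assoc flip: matrix_mul_assoc[of P _ P])
  show "E ** g = 0" "g ** E = 0"
    using gram_def[of P N] 1(2) by (simp add: matrix_mul_assoc, metis PE(6))
  have "transpose ?M = ?M"
    by (simp add: transpose_add matrix_transpose_mul)
  then show "transpose g = g"
    using transpose_matrix_inv[OF M] by (simp add: gram_def matrix_transpose_mul W)
  show "g ** (P + N ** N') = P"
  proof -
    have "g ** (P ** ?M) = (g ** P) ** ?M"
      by (simp only: matrix_mul_assoc)
    also have "\<dots> = P ** (matrix_inv ?M ** ?M)"
      by (simp only: 1) (simp only: gram_def matrix_mul_assoc)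
    finally show ?thesis
      by (simp only: PM matrix_inv_left[OF M] matrix_mul_rid)
  qed
  show "(P + N ** N') ** g = P"
  proof -
    have "(P ** ?M) ** g = P ** (?M ** matrix_inv ?M) ** P"
      by (simp only: gram_def W[symmetric] matrix_mul_assoc)
    then show ?thesis
      by (simp only: PM matrix_inv_right[OF M] matrix_mul_rid idem)
  qed
qed

lemma N_gram: "N ** g = 0" "g ** N' = 0"
  by (metis gram_rules(1) N_rules(3) matrix_mul_assoc times0_left,
      metis gram_rules(2) N_rules(8) matrix_mul_assoc times0_right)

lemmas gram_simps [simp] = gram_rules N_gram
  gram_rules(1-4)[THEN matrix_mul_assoc_rule] N_gram[THEN matrix_mul_assoc_rule]

lemma shear_inverse: "(mat 1 + N') ** (mat 1 - N') = mat 1" "(mat 1 - N') ** (mat 1 + N') = mat 1"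
  "(mat 1 + N) ** (mat 1 - N) = mat 1" "(mat 1 - N) ** (mat 1 + N) = mat 1"
  by (simp_all add: mat_expand)

lemma shear_conj:
  "(mat 1 + N') ** F ** (mat 1 + N) = S \<longleftrightarrow> F = (mat 1 - N') ** S ** (mat 1 - N)"
proof
  assume "(mat 1 + N') ** F ** (mat 1 + N) = S"
  then have "(mat 1 - N') ** S ** (mat 1 - N)
      = ((mat 1 - N') ** (mat 1 + N')) ** F ** ((mat 1 + N) ** (mat 1 - N))"
    by (simp only: matrix_mul_assoc flip: \<open>_ = S\<close>)
  then show "F = (mat 1 - N') ** S ** (mat 1 - N)"
    by (simp only: shear_inverse matrix_mul_lid matrix_mul_rid)
next
  assume "F = (mat 1 - N') ** S ** (mat 1 - N)"
  then have "(mat 1 + N') ** F ** (mat 1 + N)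
      = ((mat 1 + N') ** (mat 1 - N')) ** S ** ((mat 1 - N) ** (mat 1 + N))"
    by (simp only: matrix_mul_assoc)
  then show "(mat 1 + N') ** F ** (mat 1 + N) = S"
    by (simp only: shear_inverse matrix_mul_lid matrix_mul_rid)
qed

lemma rank_shear_conj: "rank ((mat 1 + N') ** F ** (mat 1 + N)) = rank F"
proof (rule antisym)
  let ?S = "(mat 1 + N') ** F ** (mat 1 + N)"
  show "rank ?S \<le> rank F"
    by (meson le_trans rank_mul_le_left rank_mul_le_right)
  have "F = (mat 1 - N') ** ?S ** (mat 1 - N)"
    using shear_conj by blast
  then show "rank F \<le> rank ?S"
    using rank_mul_le_left[of "(mat 1 - N') ** ?S" "mat 1 - N"] rank_mul_le_right[of "mat 1 - N'" ?S]
    by simp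
qed

end

section \<open>Block elimination and the chart of the Grassmannian\<close>

context base_projection
begin

lemma corner_eq: "corner P S = P ** S ** P + E"
  by (simp add: corner_def E_def)

lemma slope_eq: "slope P S = P ** matrix_inv (corner P S) ** S ** E"
  by (simp add: slope_def E_def)

lemma slope_locale: "base_projection_slope P (slope P S)"
  by unfold_locales (simp_all add: slope_eq matrix_mul_assoc)

lemma block_locale: "base_projection_slope P (P ** T ** E)"
  by unfold_locales (simp_all add: matrix_mul_assoc)

text \<open>\<open>corner P S\<close> is block diagonal and so commutes with \<open>P\<close>; hence
  \<open>P ** matrix_inv (corner P S)\<close> inverts \<open>A = P S P\<close> among the matrices
  \<open>P X P\<close>. The last equation is \<open>A Z^T = B\<close>, which characterises the
  slope.\<close>

lemma corner_inverse:
  assumes "invertible (corner P S)"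
  shows "(P ** S ** P) ** (P ** matrix_inv (corner P S)) = P"
    "(P ** matrix_inv (corner P S)) ** (P ** S ** P) = P"
    "(P ** S ** P) ** slope P S = P ** S ** E"
proof -
  let ?C = "corner P S" and ?A = "P ** S ** P"
  have PC: "P ** ?C = ?A" "?C ** P = ?A"
    by (simp_all add: corner_eq mat_expand)
  have R: "matrix_inv ?C ** P = P ** matrix_inv ?C"
    using PC by (intro matrix_inv_commute assms) simp
  have "?A ** (P ** matrix_inv ?C) = P ** ?C ** matrix_inv ?C"
    by (simp add: PC matrix_mul_assoc)
  also have "\<dots> = P"
    by (simp add: matrix_inv_right[OF assms] flip: matrix_mul_assoc)
  finally show 1: "?A ** (P ** matrix_inv ?C) = P" .
  have "(P ** matrix_inv ?C) ** ?A = matrix_inv ?C ** (P ** ?A)"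
    by (simp add: R[symmetric] matrix_mul_assoc)
  also have "\<dots> = matrix_inv ?C ** ?C ** P"
    by (simp add: PC(2)[symmetric] flip: matrix_mul_assoc) (simp add: PC matrix_mul_assoc)
  also have "\<dots> = P"
    by (simp add: matrix_inv_left[OF assms])
  finally show "(P ** matrix_inv ?C) ** ?A = P" .
  have "?A ** slope P S = (?A ** (P ** matrix_inv ?C)) ** S ** E"
    by (simp add: slope_eq matrix_mul_assoc)
  then show "?A ** slope P S = P ** S ** E"
    by (simp only: 1)
qed

lemma add_blocks: "P ** S ** P + P ** S ** E + E ** S ** P + E ** S ** E = S"
  using add_PE by (metis add.assoc matrix_mul_assoc)

text \<open>Block elimination: as \<open>A N\<close> is the mixed block \<open>P S E\<close>, the
  shears clear both mixed blocks and leave \<open>A\<close> and its Schur complement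
  \<open>E S E - N' A N\<close>.\<close>

lemma Gr_chart_blocks:
  assumes S: "transpose S = S" and inv: "invertible (corner P S)"
  defines "N \<equiv> slope P S" and "T \<equiv> Gr_chart P S"
  shows "(mat 1 - transpose N) ** S ** (mat 1 - N)
      = P ** S ** P + (E ** S ** E - transpose N ** (P ** S ** P) ** N)" (is "?F = ?A + ?C")
    and "P ** T ** P = P ** S ** P - gram P N" "P ** T ** E = N"
    and "E ** T ** E = E ** S ** E - transpose N ** (P ** S ** P) ** N"
    and "transpose T = T"
proof -
  interpret base_projection_slope P N
    unfolding N_def by (rule slope_locale)
  have AN: "?A ** N = P ** S ** E"
    unfolding N_def by (rule corner_inverse[OF inv])
  then have NA: "N' ** ?A = E ** S ** P"
    by (metis S matrix_mul_assoc matrix_transpose_mul transpose_PE)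
  \<comment> \<open>Because \<open>N = P ** N\<close>, only the blocks of \<open>S\<close> ending in
    \<open>P\<close> survive.\<close>
  have SN: "S ** N = P ** S ** E + N' ** ?A ** N"
  proof -
    have "S ** N = (P ** S ** P + P ** S ** E + E ** S ** P + E ** S ** E) ** N"
      by (simp only: add_blocks)
    also have "\<dots> = ?A ** N + E ** S ** P ** N"
      by (simp add: mat_expand)
    finally show ?thesis
      using AN NA by simp
  qed
  have NS: "N' ** S = E ** S ** P + N' ** ?A ** N"
  proof -
    have "N' ** S = transpose (S ** N)"
      by (simp add: matrix_transpose_mul S)
    also have "\<dots> = E ** S ** P + N' ** ?A ** N"
      unfolding SN by (simp add: transpose_add matrix_transpose_mul S matrix_mul_assoc)
    finally show ?thesis .
  qed
  have NSN: "N' ** S ** N = N' ** ?A ** N"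
    unfolding NS using arg_cong[OF NA, of "\<lambda>X. X ** N"] by (simp add: mat_expand)
  have "?F = S - S ** N - N' ** S + N' ** S ** N"
    by (simp add: mat_expand)
  also have "\<dots> = S - P ** S ** E - E ** S ** P - N' ** ?A ** N"
    unfolding NSN unfolding SN NS by simp
  also have "\<dots> = ?A + ?C"
    using add_blocks[of S] by (simp add: algebra_simps)
  finally show F: "?F = ?A + ?C" .
  have T: "T = ?A + ?C - g + N + N'"
    unfolding T_def Gr_chart_def Let_def N_def[symmetric] F ..
  show "P ** T ** P = ?A - g" "P ** T ** E = N" "E ** T ** E = ?C" "transpose T = T"
    unfolding T by (simp_all add: mat_expand transpose_add transpose_diff matrix_transpose_mul S)
qed

lemma Gr_unchart_eq:
  "Gr_unchart P T = (mat 1 + transpose (P ** T ** E)) **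
    (P ** T ** P + E ** T ** E + gram P (P ** T ** E)) ** (mat 1 + P ** T ** E)"
  by (simp add: Gr_unchart_def E_def Let_def)

lemma Gr_unchart_Gr_chart:
  assumes "transpose S = S" "invertible (corner P S)"
  shows "Gr_unchart P (Gr_chart P S) = S"
proof -
  interpret base_projection_slope P "slope P S"
    by (rule slope_locale)
  show ?thesis
    unfolding Gr_unchart_eq Gr_chart_blocks(2-4)[OF assms] shear_conj Gr_chart_blocks(1)[OF assms]
    by simp
qed

text \<open>With \<open>A = P T P + g\<close>, the reconstructed mixed block is \<open>A N\<close>.
  Once the corner is invertible, \<open>A\<close> cancels and the slope is \<open>N\<close> again;
  the inverse shears then return the diagonal blocks.\<close>

lemma Gr_unchart_blocks:
  assumes T: "transpose T = T"
  defines "N \<equiv> P ** T ** E" and "S \<equiv> Gr_unchart P T"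
  shows "corner P S = P ** T ** P + gram P N + E" "transpose S = S"
    and "invertible (corner P S) \<Longrightarrow> slope P S = N"
    and "invertible (corner P S) \<Longrightarrow> Gr_chart P S = T"
proof -
  interpret base_projection_slope P N
    unfolding N_def by (rule block_locale)
  let ?F = "P ** T ** P + E ** T ** E + g"
  have S: "S = (mat 1 + N') ** ?F ** (mat 1 + N)"
    unfolding S_def N_def by (rule Gr_unchart_eq)
  have A: "P ** S ** P = P ** T ** P + g" and AN: "P ** S ** E = (P ** T ** P + g) ** N"
    unfolding S by (simp_all add: mat_expand)
  show C: "corner P S = P ** T ** P + g + E"
    by (simp add: corner_eq A)
  show symS: "transpose S = S"
    unfolding S by (simp add: matrix_transpose_mul transpose_add T matrix_mul_assoc)
  show slope: "slope P S = N" if inv: "invertible (corner P S)"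
  proof -
    have "slope P S = P ** slope P S"
      using base_projection_slope.PN[OF slope_locale] by simp
    also have "\<dots> = (P ** matrix_inv (corner P S)) ** (P ** S ** P) ** slope P S"
      by (simp only: corner_inverse(2)[OF inv])
    also have "\<dots> = (P ** matrix_inv (corner P S)) ** (P ** S ** E)"
      by (rule trans[OF matrix_mul_assoc[symmetric]]) (simp only: corner_inverse(3)[OF inv])
    also have "\<dots> = (P ** matrix_inv (corner P S)) ** (P ** S ** P) ** N"
      by (simp add: A AN matrix_mul_assoc)
    also have "\<dots> = N"
      by (simp add: corner_inverse(2)[OF inv])
    finally show ?thesis .
  qed
  show "Gr_chart P S = T" if inv: "invertible (corner P S)"
  proof -
    have "?F = (mat 1 - N') ** S ** (mat 1 - N)"
      using S shear_conj by metis
    then have "Gr_chart P S = ?F - g + N + N'"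
      unfolding Gr_chart_def Let_def slope[OF inv] by simp
    also have "\<dots> = P ** T ** P + P ** T ** E + E ** T ** P + E ** T ** E"
      by (simp add: N_def matrix_transpose_mul T matrix_mul_assoc)
    finally show ?thesis
      by (simp only: add_blocks)
  qed
qed

text \<open>Shears preserve rank, and \<open>A\<close> already has the rank of \<open>P\<close>, so
  equal rank forces the Schur complement to vanish. Idempotency then becomes an equation for
  \<open>A\<close> alone, whose only invertible solution is \<open>g\<close>.\<close>

lemma projection_iff_Gr_chart:
  assumes S: "transpose S = S" and inv: "invertible (corner P S)"
  defines "T \<equiv> Gr_chart P S"
  shows "S = S ** S \<and> rank S = rank P \<longleftrightarrow> P ** T ** P = 0 \<and> E ** T ** E = 0"
proof -
  define N where "N = slope P S"
  interpret base_projection_slope P N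
    unfolding N_def by (rule slope_locale)
  let ?A = "P ** S ** P" and ?R = "P ** matrix_inv (corner P S)"
  define F where "F = ?A + E ** T ** E"
  have F: "F = (mat 1 - N') ** S ** (mat 1 - N)"
    unfolding F_def N_def T_def Gr_chart_blocks(1)[OF assms(1,2)] Gr_chart_blocks(4)[OF assms(1,2)] ..
  then have SF: "S = (mat 1 + N') ** F ** (mat 1 + N)"
    using shear_conj by metis
  have PTP: "P ** T ** P = ?A - g"
    unfolding T_def N_def using Gr_chart_blocks(2)[OF assms(1,2)] .
  show ?thesis
  proof
    assume proj: "S = S ** S \<and> rank S = rank P"
    \<comment> \<open>\<open>F P = A\<close> has at least the rank of \<open>P\<close>, which is
      also the rank of \<open>F\<close>. So \<open>F\<close> and \<open>F P\<close> have the same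
      range, and \<open>E\<close> annihilates it.\<close>
    have FP: "F ** P = ?A"
      by (simp add: F_def mat_expand)
    have "range ((*v) F) = range ((*v) (F ** P))"
    proof (rule subspace_dim_equal[symmetric])
      have "rank P = rank (?A ** ?R)"
        by (simp only: corner_inverse[OF inv])
      also have "\<dots> \<le> rank ?A"
        by (rule rank_mul_le_left)
      finally have "rank S \<le> rank (F ** P)"
        using proj by (simp add: FP)
      then have "rank F \<le> rank (F ** P)"
        using SF rank_shear_conj by metis
      then show "dim (range ((*v) F)) \<le> dim (range ((*v) (F ** P)))"
        by (simp add: rank_dim_range)
      show "range ((*v) (F ** P)) \<subseteq> range ((*v) F)"
        by (auto simp flip: matrix_vector_mul_assoc)
    qed (auto intro!: linear_subspace_image)
    then have "E ** F *v x = 0" for x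
    proof -
      have "F *v x \<in> range ((*v) (F ** P))"
        using \<open>range ((*v) F) = _\<close> by blast
      then obtain y where "F *v x = F ** P *v y"
        by blast
      then have "E ** F *v x = E ** (F ** P) *v y"
        by (simp flip: matrix_vector_mul_assoc)
      also have "E ** (F ** P) = 0"
        unfolding FP by (simp add: matrix_mul_assoc)
      finally show ?thesis by simp
    qed
    then have "E ** F = 0"
      by (simp add: matrix_eq)
    then have ETE: "E ** T ** E = 0"
      unfolding F_def by (simp add: mat_expand)
    then have FA: "F = ?A"
      by (simp add: F_def)
    \<comment> \<open>In the sheared frame, \<open>S = S S\<close> reads
      \<open>A = A (P + N N') A\<close>. Cancelling the left \<open>A\<close> by \<open>?R\<close>
      and multiplying by \<open>g\<close> leaves \<open>A = g\<close>.\<close>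
    have "F = (mat 1 - N') ** (S ** S) ** (mat 1 - N)"
      using F proj by simp
    also have "\<dots> = ((mat 1 - N') ** (mat 1 + N')) ** F ** (mat 1 + N) ** (mat 1 + N') ** F
        ** ((mat 1 + N) ** (mat 1 - N))"
      by (subst (1 2) SF) (simp only: matrix_mul_assoc)
    also have "\<dots> = F ** (mat 1 + N) ** (mat 1 + N') ** F"
      by (simp only: shear_inverse matrix_mul_lid matrix_mul_rid)
    also have "\<dots> = ?A ** ((P + N ** N') ** ?A)"
      unfolding FA by (simp add: mat_expand)
    finally have "?R ** ?A = ?R ** (?A ** ((P + N ** N') ** ?A))"
      unfolding FA by simp
    then have "P = P ** ((P + N ** N') ** ?A)"
      by (simp only: matrix_mul_assoc[of ?R ?A] corner_inverse[OF inv])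
    then have "P = (P + N ** N') ** ?A"
      by (simp add: mat_expand)
    then have "g ** P = (g ** (P + N ** N')) ** ?A"
      by (metis matrix_mul_assoc)
    then have "?A = g"
      by (simp add: gram_inverse matrix_mul_assoc)
    then show "P ** T ** P = 0 \<and> E ** T ** E = 0"
      using PTP ETE by simp
  next
    assume zero: "P ** T ** P = 0 \<and> E ** T ** E = 0"
    then have Fg: "F = g"
      using PTP by (simp add: F_def)
    have "S ** S = (mat 1 + N') ** (g ** (mat 1 + N) ** (mat 1 + N') ** g) ** (mat 1 + N)"
      unfolding SF Fg by (simp only: matrix_mul_assoc)
    also have "g ** (mat 1 + N) ** (mat 1 + N') ** g = (g ** (P + N ** N')) ** g"
      by (simp add: mat_expand)
    also have "\<dots> = g"
      by (simp only: gram_inverse gram_rules)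
    finally have "S = S ** S"
      using SF Fg by simp
    moreover have "rank S = rank g"
      using SF Fg rank_shear_conj by metis
    \<comment> \<open>Each of \<open>g\<close> and \<open>P\<close> is a right multiple of the
      other.\<close>
    moreover have "rank g = rank P"
      using rank_mul_le_left[of P "matrix_inv (mat 1 + N ** N')"]
        rank_mul_le_left[of g "P + N ** N'"]
      by (simp add: gram_inverse gram_def[symmetric])
    ultimately show "S = S ** S \<and> rank S = rank P"
      by simp
  qed
qed


text \<open>Equality of the kernels of \<open>S\<close> and \<open>K\<close>, stated as mutual left
  divisibility: in this form \<open>mode_prod_mode_prod\<close> transfers it to
  \<open>X x_k S = 0\<close> and \<open>X x_k K = 0\<close>. Both parts come from
  \<open>S = (1 + N') g (1 + N)\<close>, the first with \<open>(P + N N') g = P\<close>.\<close>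

lemma projection_factor:
  assumes S: "transpose S = S" and inv: "invertible (corner P S)"
    and "S = S ** S" "rank S = rank P"
  defines "K \<equiv> P ** (mat 1 + slope P S)"
  shows "K ** S = K" and "\<exists>B. S = B ** K"
proof -
  define N where "N = slope P S"
  interpret base_projection_slope P N
    unfolding N_def by (rule slope_locale)
  have blocks: "P ** Gr_chart P S ** P = 0" "E ** Gr_chart P S ** E = 0"
    using projection_iff_Gr_chart[OF S inv] assms(3,4) by simp_all
  have S_eq: "S = (mat 1 + N') ** g ** (mat 1 + N)"
    using Gr_unchart_Gr_chart[OF S inv]
    unfolding Gr_unchart_eq blocks Gr_chart_blocks(3)[OF S inv] N_def[symmetric] by simp
  have "K ** S = ((P + N ** N') ** g) ** (mat 1 + N)"
    unfolding K_def N_def[symmetric] by (subst S_eq) (simp add: mat_expand)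
  then show "K ** S = K"
    unfolding K_def N_def[symmetric] by (simp only: gram_inverse)
  have "S = ((mat 1 + N') ** g) ** K"
    unfolding K_def N_def[symmetric] by (subst S_eq) (simp add: mat_expand)
  then show "\<exists>B. S = B ** K"
    by blast
qed

end

text \<open>\<open>D\<close> stands for the coordinate projection onto \<open>I k\<close>. The chart
  formulas contain full-size identities, so preservation of support is a claim of its own. It is
  tracked on the left, where the leading factor decides; transposition gives the right side.\<close>

locale supported_projection = base_projection P for P :: "real ^ 'n ^ 'n" +
  fixes D :: "real ^ 'n ^ 'n"
  assumes D_sym: "transpose D = D" and DP: "D ** P = P"
begin

lemma support_mult: "D ** A = A \<Longrightarrow> D ** (A ** B) = A ** B"
  by (simp add: matrix_mul_assoc)

lemma support_E: "D ** A = A \<Longrightarrow> D ** (E ** A) = E ** A"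
  by (simp add: E_def matrix_diff_ldistrib matrix_diff_rdistrib matrix_mul_assoc DP)

text \<open>The slope begins with \<open>P\<close> and, as \<open>S\<close> is symmetric, its
  transpose begins with \<open>E ** S\<close>; both leading factors absorb \<open>D\<close>.\<close>

lemma support_slope:
  assumes "transpose S = S" "D ** S = S"
  shows "D ** slope P S = slope P S" "D ** transpose (slope P S) = transpose (slope P S)"
    "slope P S ** D = slope P S"
proof -
  show "D ** slope P S = slope P S"
    by (simp add: slope_eq support_mult DP flip: matrix_mul_assoc)
  have "transpose (slope P S) = (E ** S) ** (transpose (matrix_inv (corner P S)) ** P)"
    by (simp add: slope_eq matrix_transpose_mul assms matrix_mul_assoc)
  then show *: "D ** transpose (slope P S) = transpose (slope P S)"
    by (simp only: support_mult[OF support_E[OF assms(2)]])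
  show "slope P S ** D = slope P S"
    using arg_cong[OF *, of transpose] by (simp add: matrix_transpose_mul D_sym)
qed

lemma support_Gr_chart:
  assumes "transpose S = S" "D ** S = S"
  shows "D ** Gr_chart P S = Gr_chart P S"
proof -
  have "D ** ((mat 1 - transpose (slope P S)) ** S) = (mat 1 - transpose (slope P S)) ** S"
    using support_slope[OF assms]
    by (simp add: matrix_diff_rdistrib matrix_diff_ldistrib support_mult assms)
  moreover have "D ** gram P N = gram P N" for N
    by (simp add: gram_def support_mult DP)
  ultimately show ?thesis
    using support_slope[OF assms]
    by (simp add: Gr_chart_def Let_def matrix_diff_ldistrib matrix_add_ldistrib support_mult)
qed

lemma support_Gr_unchart:
  assumes "transpose T = T" "D ** T = T"
  shows "D ** Gr_unchart P T = Gr_unchart P T"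
proof -
  let ?N = "P ** T ** E"
  let ?F = "P ** T ** P + E ** T ** E + gram P ?N"
  have "D ** (P ** T ** P) = P ** T ** P" "D ** gram P ?N = gram P ?N"
    by (simp_all add: gram_def support_mult DP flip: matrix_mul_assoc)
  moreover have "D ** (E ** T ** E) = E ** T ** E"
    by (simp add: support_mult[OF support_E[OF assms(2)]])
  ultimately have F: "D ** ?F = ?F"
    by (simp add: matrix_add_ldistrib)
  have "transpose ?N = (E ** T) ** P"
    by (simp add: matrix_transpose_mul assms matrix_mul_assoc)
  then have "D ** (transpose ?N ** ?F) = transpose ?N ** ?F"
    by (simp only: support_mult[OF support_mult[OF support_E[OF assms(2)]]])
  then have "D ** ((mat 1 + transpose ?N) ** ?F) = (mat 1 + transpose ?N) ** ?F"
    using F by (simp only: matrix_add_rdistrib matrix_mul_lid) (simp only: matrix_add_ldistrib)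
  then show ?thesis
    unfolding Gr_unchart_eq by (rule support_mult)
qed

end

section \<open>Dimension of the model space\<close>

definition coord_proj :: "'n set \<Rightarrow> real ^ 'n ^ 'n"
  where "coord_proj J = (\<chi> i j. if i = j \<and> i \<in> J then 1 else 0)"

lemma coord_proj_mult: "(coord_proj J ** A) $ i $ j = (if i \<in> J then A $ i $ j else 0)"
proof -
  have "(coord_proj J ** A) $ i $ j = (\<Sum>l\<in>UNIV. if l = i then (if i \<in> J then A $ i $ j else 0) else 0)"
    unfolding coord_proj_def matrix_matrix_mult_def vec_lambda_beta by (intro sum.cong) auto
  then show ?thesis by simp
qed

lemma transpose_coord_proj: "transpose (coord_proj J) = coord_proj J"
  by (auto simp: transpose_def coord_proj_def vec_eq_iff)

lemma trace_coord_proj: "trace (coord_proj J) = card J"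
  by (simp add: trace_def coord_proj_def flip: sum.inter_filter)

text \<open>Turns support into a matrix identity, the form that fits the algebra of the charts.
  Bounding the rows suffices because symmetry transfers the bound to the columns.\<close>

lemma Sym_iff: "A \<in> Sym J \<longleftrightarrow> transpose A = A \<and> coord_proj J ** A = A"
proof -
  have "coord_proj J ** A = A \<longleftrightarrow> (\<forall>i j. i \<notin> J \<longrightarrow> A $ i $ j = 0)"
    by (auto simp: vec_eq_iff coord_proj_mult)
  moreover have "(\<forall>i j. i \<notin> J \<or> j \<notin> J \<longrightarrow> A $ i $ j = 0) \<longleftrightarrow> (\<forall>i j. i \<notin> J \<longrightarrow> A $ i $ j = 0)"
    if sym: "transpose A = A"
  proof (intro iffI allI impI)
    fix i j
    have "A $ i $ j = A $ j $ i"
      using arg_cong[OF sym, of "\<lambda>B. B $ j $ i"] by (simp add: transpose_def)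
    moreover assume "\<forall>i j. i \<notin> J \<longrightarrow> A $ i $ j = 0" "i \<notin> J \<or> j \<notin> J"
    ultimately show "A $ i $ j = 0"
      by auto
  qed auto
  ultimately show ?thesis
    unfolding Sym_def by blast
qed

lemma Sym_mult_coord_proj: "A \<in> Sym J \<Longrightarrow> A ** coord_proj J = A"
  unfolding Sym_iff by (metis matrix_transpose_mul transpose_coord_proj)

text \<open>Supplies a point of the Grassmannian for non-emptiness; the case \<open>K = J\<close>
  gives idempotency of \<open>coord_proj J\<close>.\<close>

lemma coord_proj_in_Gr:
  assumes "K \<subseteq> J"
  shows "coord_proj K \<in> Gr (card K) J"
proof -
  have idem: "coord_proj K ** coord_proj K = coord_proj K"
    by (auto simp: vec_eq_iff coord_proj_mult) (auto simp: coord_proj_def)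
  have "real (rank (coord_proj K)) = real (card K)"
    using rank_eq_trace[OF transpose_coord_proj idem] trace_coord_proj by metis
  moreover have "coord_proj J ** coord_proj K = coord_proj K"
    using assms by (auto simp: vec_eq_iff coord_proj_mult) (auto simp: coord_proj_def)
  ultimately show ?thesis
    by (simp add: Gr_def Sym_iff transpose_coord_proj idem)
qed

lemma mode_prod_coord_proj: "mode_prod X k (coord_proj J) $ i = (if i k \<in> J then X $ i else 0)"
proof -
  have "mode_prod X k (coord_proj J) $ i
      = (\<Sum>l\<in>UNIV. if l = i k then (if i k \<in> J then X $ i else 0) else 0)"
    unfolding mode_prod_def coord_proj_def vec_lambda_beta by (intro sum.cong) auto
  then show ?thesis by simp
qed

lemma tensors_iff: "X \<in> tensors I \<longleftrightarrow> (\<forall>k. mode_prod X k (coord_proj (I k)) = X)"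
  by (auto simp: tensors_def vec_eq_iff mode_prod_coord_proj)

text \<open>\<open>Q\<close> complements \<open>P\<close> inside the coordinate space of
  \<open>J\<close>, unlike \<open>1 - P\<close>, which also contains the coordinates outside
  \<open>J\<close>. This is why its trace is \<open>r\<close>.\<close>

lemma complement_projection:
  assumes P: "P \<in> Gr (card J - r) J" and r: "r \<le> card J"
  defines "Q \<equiv> coord_proj J - P"
  shows "transpose Q = Q" "Q ** Q = Q" "P ** Q = 0" "Q ** P = 0" "trace Q = r"
    "trace P = card J - r"
proof -
  have *: "transpose P = P" "P ** P = P" "coord_proj J ** P = P" "P ** coord_proj J = P"
    "rank P = card J - r"
    using P by (auto simp: Gr_def Sym_iff Sym_mult_coord_proj)
  have DD: "coord_proj J ** coord_proj J = coord_proj J"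
    using coord_proj_in_Gr[of J J] by (simp add: Gr_def)
  show "trace P = card J - r"
    using rank_eq_trace[OF *(1,2)] * by simp
  then show "trace Q = r"
    using r by (simp add: Q_def trace_sub trace_coord_proj of_nat_diff)
  show "transpose Q = Q" "Q ** Q = Q" "P ** Q = 0" "Q ** P = 0"
    by (simp_all add: Q_def * DD transpose_diff transpose_coord_proj matrix_diff_ldistrib matrix_diff_rdistrib)
qed

text \<open>Being supported and killed by \<open>P k\<close> means being fixed by \<open>Q k\<close>
  in mode \<open>k\<close>. The space is thus the range of \<open>multi_prod Q\<close>, an
  orthogonal projection whose trace is the product of the traces \<open>r k\<close>.\<close>

lemma dim_tensor_kernel:
  fixes P :: "'d::finite \<Rightarrow> real ^ 'n::finite ^ 'n"
  assumes P: "\<And>k. P k \<in> Gr (card (I k) - r k) (I k)" and r: "\<And>k. r k \<le> card (I k)"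
  shows "dim {X \<in> tensors I. \<forall>k. mode_prod X k (P k) = 0} = (\<Prod>k\<in>UNIV. r k)"
proof -
  define Q where "Q k = coord_proj (I k) - P k" for k
  note Q = complement_projection[OF P r, folded Q_def]
  have "coord_proj (I k) ** P k = P k" for k
    using P[of k] by (auto simp: Gr_def Sym_iff)
  then have DQ: "coord_proj (I k) ** Q k = Q k" for k
    using coord_proj_in_Gr[of "I k" "I k"] by (simp add: Gr_def Q_def matrix_diff_ldistrib)
  have "X \<in> range (multi_prod Q)" if "X \<in> tensors I" "\<forall>k. mode_prod X k (P k) = 0" for X
  proof -
    have "mode_prod X k (Q k) = X" for k
      using that by (simp add: Q_def mode_prod_diff tensors_iff)
    from multi_prod_eq_self[of X Q, OF this] show ?thesis
      by (metis rangeI)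
  qed
  moreover have "multi_prod Q X \<in> tensors I" "mode_prod (multi_prod Q X) k (P k) = 0" for X k
    by (simp_all add: tensors_iff mode_prod_multi_prod DQ Q multi_prod_eq_0[of _ k])
  ultimately have "{X \<in> tensors I. \<forall>k. mode_prod X k (P k) = 0} = range (multi_prod Q)"
    by blast
  moreover have "real (dim (range (multi_prod Q))) = (\<Sum>b\<in>Basis. multi_prod Q b \<bullet> b)"
    by (intro dim_range_orthogonal_projection linear_multi_prod)
       (simp_all add: multi_prod_multi_prod inner_multi_prod Q)
  ultimately have "real (dim {X \<in> tensors I. \<forall>k. mode_prod X k (P k) = 0}) = real (\<Prod>k\<in>UNIV. r k)"
    by (simp add: trace_multi_prod Q)
  then show ?thesis
    by (simp only: of_nat_eq_iff)
qed

section \<open>Mixed blocks of symmetric matrices\<close>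

lemma inner_matrix_mult_left: "(A ** B) \<bullet> C = B \<bullet> (transpose A ** C)" for A B C :: "real ^ 'n ^ 'n"
proof -
  have "(A ** B) \<bullet> C = (\<Sum>i\<in>UNIV. \<Sum>j\<in>UNIV. \<Sum>k\<in>UNIV. A $ i $ k * B $ k $ j * C $ i $ j)"
    by (simp add: inner_vec_def matrix_matrix_mult_def sum_distrib_right)
  also have "\<dots> = (\<Sum>i\<in>UNIV. \<Sum>k\<in>UNIV. \<Sum>j\<in>UNIV. A $ i $ k * B $ k $ j * C $ i $ j)"
    by (intro sum.cong refl sum.swap)
  also have "\<dots> = (\<Sum>k\<in>UNIV. \<Sum>i\<in>UNIV. \<Sum>j\<in>UNIV. A $ i $ k * B $ k $ j * C $ i $ j)"
    by (rule sum.swap)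
  also have "\<dots> = (\<Sum>k\<in>UNIV. \<Sum>j\<in>UNIV. \<Sum>i\<in>UNIV. A $ i $ k * B $ k $ j * C $ i $ j)"
    by (intro sum.cong refl sum.swap)
  also have "\<dots> = B \<bullet> (transpose A ** C)"
    by (simp add: inner_vec_def matrix_matrix_mult_def transpose_def sum_distrib_left algebra_simps)
  finally show ?thesis .
qed

lemma inner_transpose: "transpose A \<bullet> transpose B = A \<bullet> B" for A B :: "real ^ 'n ^ 'n"
  unfolding inner_vec_def transpose_def vec_lambda_beta by (rule sum.swap)

lemma inner_matrix_mult_right: "(A ** B) \<bullet> C = A \<bullet> (C ** transpose B)" for A B C :: "real ^ 'n ^ 'n"
proof -
  have "(A ** B) \<bullet> C = (transpose B ** transpose A) \<bullet> transpose C"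
    by (simp only: inner_transpose flip: matrix_transpose_mul)
  also have "\<dots> = transpose A \<bullet> (B ** transpose C)"
    by (simp only: inner_matrix_mult_left transpose_transpose)
  also have "\<dots> = transpose A \<bullet> transpose (C ** transpose B)"
    by (simp add: matrix_transpose_mul)
  finally show ?thesis
    by (simp only: inner_transpose)
qed

text \<open>Symmetrise, then keep the two mixed blocks: the orthogonal projection onto the tangent
  directions of the Grassmannian at \<open>P\<close>. The factor \<open>1/2\<close> belongs to the
  symmetrisation.\<close>

definition off_diagonal :: "real ^ 'n ^ 'n \<Rightarrow> real ^ 'n ^ 'n \<Rightarrow> real ^ 'n ^ 'n \<Rightarrow> real ^ 'n ^ 'n"
  where "off_diagonal P Q T =
    (1/2) *\<^sub>R (P ** (T + transpose T) ** Q + Q ** (T + transpose T) ** P)"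

lemma off_diagonal_orthogonal_projection:
  fixes P Q :: "real ^ 'n::finite ^ 'n"
  assumes sym: "transpose P = P" "transpose Q = Q" and idem: "P ** P = P" "Q ** Q = Q"
    and orth: "P ** Q = 0" "Q ** P = 0"
  shows "linear (off_diagonal P Q)" "off_diagonal P Q (off_diagonal P Q T) = off_diagonal P Q T"
    "off_diagonal P Q T \<bullet> U = T \<bullet> off_diagonal P Q U"
    "transpose (off_diagonal P Q T) = off_diagonal P Q T"
    "(\<Sum>b\<in>Basis. off_diagonal P Q b \<bullet> b) = trace P * trace Q"
proof -
  let ?f = "off_diagonal P Q"
  show lin: "linear ?f"
    by (rule linearI)
       (simp_all add: off_diagonal_def transpose_add transpose_scalar matrix_add_ldistrib
         matrix_add_rdistrib scaleR_add_right matrix_scalar_ac flip: scalar_matrix_assoc)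
  show tr: "transpose (?f T) = ?f T" for T
    by (simp add: off_diagonal_def transpose_add transpose_scalar matrix_transpose_mul sym
        matrix_mul_assoc matrix_add_ldistrib matrix_add_rdistrib algebra_simps)
  note red = idem orth idem[THEN matrix_mul_assoc_rule] orth[THEN matrix_mul_assoc_rule]
  have "?f T + transpose (?f T) = 2 *\<^sub>R ?f T"
    unfolding tr by (simp add: scaleR_2)
  then have "?f (?f T) = P ** ?f T ** Q + Q ** ?f T ** P"
    unfolding off_diagonal_def[of P Q "?f T"]
    by (simp add: matrix_scalar_ac scaleR_add_right flip: scalar_matrix_assoc)
  also have "\<dots> = ?f T"
    by (simp add: off_diagonal_def matrix_mul_assoc matrix_add_ldistrib matrix_add_rdistrib
        matrix_scalar_ac scaleR_add_right red flip: scalar_matrix_assoc)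
  finally show "?f (?f T) = ?f T" .
  have adj: "(P ** T ** Q) \<bullet> U = T \<bullet> (P ** U ** Q)" "(Q ** T ** P) \<bullet> U = T \<bullet> (Q ** U ** P)" for T U
    by (simp_all only: inner_matrix_mult_right[of "_ ** T"] inner_matrix_mult_left[of _ T] sym matrix_mul_assoc)
  have tr_adj: "transpose A \<bullet> B = A \<bullet> transpose B" for A B :: "real ^ 'n ^ 'n"
    by (metis inner_transpose transpose_transpose)
  show "?f T \<bullet> U = T \<bullet> ?f U"
    by (simp add: off_diagonal_def inner_add_left inner_add_right adj matrix_add_ldistrib
        matrix_add_rdistrib tr_adj matrix_transpose_mul sym matrix_mul_assoc)
  have PQ: "(\<Sum>i\<in>UNIV. \<Sum>j\<in>UNIV. P $ i $ j * Q $ i $ j) = 0"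
  proof -
    have "(\<Sum>i\<in>UNIV. \<Sum>j\<in>UNIV. P $ i $ j * Q $ i $ j) = P \<bullet> Q"
      by (simp add: inner_vec_def)
    also have "\<dots> = (mat 1 ** P) \<bullet> Q"
      by simp
    also have "\<dots> = 0"
      by (simp only: inner_matrix_mult_right sym orth inner_zero_right)
    finally show ?thesis .
  qed
  have entry: "(A ** axis i (axis j 1) ** B) $ k $ l = A $ k $ i * B $ j $ l"
    for A B :: "real ^ 'n ^ 'n" and i j k l
  proof -
    have "(A ** axis i (axis j 1)) $ k $ m = (if m = j then A $ k $ i else 0)" for m
      by (simp add: matrix_matrix_mult_def axis_def if_distrib[where f = "\<lambda>c. _ * c"]
          if_distrib[where f = "\<lambda>c. c $ _"] sum.delta' cong: if_cong)
    then show ?thesis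
      by (simp add: matrix_matrix_mult_def[of "A ** _"] if_distrib[where f = "\<lambda>c. c * _"] cong: if_cong)
  qed
  have axis_tr: "transpose (axis i (axis j 1)) = axis j (axis i (1::real))" for i j :: 'n
    by (auto simp: transpose_def axis_def vec_eq_iff)
  have "(\<Sum>b\<in>Basis. ?f b \<bullet> b) = (\<Sum>i\<in>UNIV. \<Sum>j\<in>UNIV. ?f (axis i (axis j 1)) $ i $ j)"
    by (simp add: sum_Basis_vec inner_axis)
  \<comment> \<open>Symmetrising the unit matrix at \<open>(i, j)\<close> adds the one at
    \<open>(j, i)\<close>; the latter yields the terms \<open>P $ i $ j * Q $ i $ j\<close>, which
    sum to the inner product of \<open>P\<close> and \<open>Q\<close>, zero by
    \<open>PQ\<close>.\<close>
  also have "\<dots> = (\<Sum>i\<in>UNIV. \<Sum>j\<in>UNIV. (1/2) * (P $ i $ i * Q $ j $ j + P $ j $ j * Q $ i $ i)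
      + P $ i $ j * Q $ i $ j)"
    by (simp add: off_diagonal_def matrix_add_ldistrib matrix_add_rdistrib axis_tr entry algebra_simps)
  also have "\<dots> = trace P * trace Q"
  proof -
    have 1: "(\<Sum>i\<in>UNIV. \<Sum>j\<in>UNIV. P $ i $ i * Q $ j $ j) = trace P * trace Q"
      by (simp add: trace_def sum_product)
    have 2: "(\<Sum>i\<in>UNIV. \<Sum>j\<in>UNIV. P $ j $ j * Q $ i $ i) = trace P * trace Q"
      by (subst sum.swap) (rule 1)
    have "(\<Sum>i\<in>UNIV. \<Sum>j\<in>UNIV. (1/2) * (P $ i $ i * Q $ j $ j + P $ j $ j * Q $ i $ i)
        + P $ i $ j * Q $ i $ j)
      = (1/2) * ((\<Sum>i\<in>UNIV. \<Sum>j\<in>UNIV. P $ i $ i * Q $ j $ j)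
        + (\<Sum>i\<in>UNIV. \<Sum>j\<in>UNIV. P $ j $ j * Q $ i $ i))
        + (\<Sum>i\<in>UNIV. \<Sum>j\<in>UNIV. P $ i $ j * Q $ i $ j)"
      by (simp only: sum.distrib sum_distrib_left distrib_left)
    then show ?thesis
      by (simp only: 1 2 PQ) simp
  qed
  finally show "(\<Sum>b\<in>Basis. ?f b \<bullet> b) = trace P * trace Q" .
qed

text \<open>Support on \<open>J\<close> gives \<open>T = (P + Q) T (P + Q)\<close>, and
  \<open>Q = Q E = E Q\<close> makes \<open>Q T Q\<close> vanish together with \<open>E T E\<close>;
  only the mixed blocks remain.\<close>

lemma range_off_diagonal:
  assumes P: "P \<in> Gr (card J - r) J" and r: "r \<le> card J"
  defines "E \<equiv> mat 1 - P"
  shows "range (off_diagonal P (coord_proj J - P)) = {T \<in> Sym J. P ** T ** P = 0 \<and> E ** T ** E = 0}"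
proof -
  define Q where "Q = coord_proj J - P"
  note Q = complement_projection[OF P r, folded Q_def]
  have P': "transpose P = P" "P ** P = P" "coord_proj J ** P = P"
    using P by (auto simp: Gr_def Sym_iff)
  have DQ: "coord_proj J ** Q = Q"
    using coord_proj_in_Gr[of J J] P' by (simp add: Gr_def Q_def matrix_diff_ldistrib)
  note f = off_diagonal_orthogonal_projection[OF P'(1) Q(1) P'(2) Q(2-4)]
  have EPQ: "E ** P = 0" "P ** E = 0" "E ** Q = Q" "Q ** E = Q"
    by (simp_all add: E_def matrix_diff_ldistrib matrix_diff_rdistrib P' Q)
  note red = P' DQ Q EPQ P'(2)[THEN matrix_mul_assoc_rule] Q(2-4)[THEN matrix_mul_assoc_rule]
    EPQ[THEN matrix_mul_assoc_rule]
  note expand = off_diagonal_def matrix_mul_assoc matrix_add_ldistrib matrix_add_rdistrib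
    matrix_scalar_ac scaleR_add_right
  have "off_diagonal P Q T \<in> Sym J" "P ** off_diagonal P Q T ** P = 0"
    "E ** off_diagonal P Q T ** E = 0" for T
    using f(4) by (simp_all add: Sym_iff) (simp_all add: expand red flip: scalar_matrix_assoc)
  moreover have "T \<in> range (off_diagonal P Q)"
    if T: "T \<in> Sym J" "P ** T ** P = 0" "E ** T ** E = 0" for T
  proof -
    have DTD: "(coord_proj J ** T) ** coord_proj J = T"
      using T Sym_mult_coord_proj by (metis Sym_iff)
    have "Q ** T ** Q = Q ** (E ** T ** E) ** Q"
      by (simp add: matrix_mul_assoc red)
    then have QTQ: "Q ** T ** Q = 0"
      using T by simp
    have "T = ((P + Q) ** T) ** (P + Q)"
      using DTD by (simp add: Q_def)
    also have "\<dots> = P ** T ** Q + Q ** T ** P"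
      using T QTQ by (simp add: matrix_add_ldistrib matrix_add_rdistrib)
    also have "\<dots> = off_diagonal P Q T"
    proof -
      have "T + transpose T = 2 *\<^sub>R T"
        using T by (simp add: Sym_iff scaleR_2)
      then show ?thesis
        by (simp add: off_diagonal_def matrix_scalar_ac scaleR_add_right flip: scalar_matrix_assoc)
    qed
    finally show ?thesis
      by (rule range_eqI)
  qed
  ultimately show ?thesis
    unfolding Q_def by blast
qed

lemma dim_off_diagonal_blocks:
  fixes P :: "real ^ 'n ^ 'n ^ 'd"
  assumes P: "\<And>k. P $ k \<in> Gr (card (I k) - r k) (I k)" and r: "\<And>k. r k \<le> card (I k)"
  shows "dim {T :: real ^ 'n ^ 'n ^ 'd. \<forall>k. T $ k \<in> Sym (I k) \<and>
      P $ k ** T $ k ** P $ k = 0 \<and> (mat 1 - P $ k) ** T $ k ** (mat 1 - P $ k) = 0}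
    = (\<Sum>k\<in>UNIV. r k * (card (I k) - r k))" (is "dim ?L = _")
proof -
  define Q where "Q k = coord_proj (I k) - P $ k" for k
  note Q = complement_projection[OF P r, folded Q_def]
  have P': "transpose (P $ k) = P $ k" "P $ k ** P $ k = P $ k" for k
    using P[of k] by (auto simp: Gr_def Sym_iff)
  note f = off_diagonal_orthogonal_projection[OF P'(1) Q(1) P'(2) Q(2-4)]
  have "?L = {T. \<forall>k. T $ k \<in> range (off_diagonal (P $ k) (Q k))}"
    unfolding Q_def range_off_diagonal[OF P r] by simp
  then have "dim ?L = (\<Sum>k\<in>UNIV. dim (range (off_diagonal (P $ k) (Q k))))"
    using f by (simp only: dim_vec_range_orthogonal_projection)
  also have "\<dots> = (\<Sum>k\<in>UNIV. r k * (card (I k) - r k))"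
  proof (intro sum.cong refl)
    fix k
    have "real (dim (range (off_diagonal (P $ k) (Q k)))) = trace (P $ k) * trace (Q k)"
      using dim_range_orthogonal_projection[OF f(1-3)] f(5) by metis
    then show "dim (range (off_diagonal (P $ k) (Q k))) = r k * (card (I k) - r k)"
      by (simp add: Q flip: of_nat_mult)
  qed
  finally show ?thesis .
qed

section \<open>The desingularization\<close>

lemma linear_matrix_conj: "linear (\<lambda>A :: real ^ 'n ^ 'n. B ** A ** C)"
  by (rule linearI)
     (simp_all add: matrix_add_ldistrib matrix_add_rdistrib matrix_scalar_ac flip: scalar_matrix_assoc)

lemma smooth_on_multi_prod [smooth_intros]:
  fixes G :: "'a::euclidean_space \<Rightarrow> 'd::finite \<Rightarrow> real ^ 'n::finite ^ 'n"
  assumes "\<And>k. smooth_on E S (\<lambda>x. G x k)" "smooth_on E S X"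
  shows "smooth_on E S (\<lambda>x. multi_prod (G x) (X x))"
  unfolding multi_prod_def using assms by (intro smooth_intros)

lemma smooth_on_gram [smooth_intros]:
  assumes "smooth_on E S N"
  shows "smooth_on E S (\<lambda>x. gram P (N x))"
proof -
  have "det (mat 1 + N x ** transpose (N x)) \<noteq> 0" for x
    using invertible_mat_1_plus_gram invertible_det_nz by blast
  then show ?thesis
    unfolding gram_def using assms by (intro smooth_intros) auto
qed

lemma smooth_on_corner [smooth_intros]: "smooth_on E S A \<Longrightarrow> smooth_on E S (\<lambda>x. corner P (A x))"
  unfolding corner_def by (intro smooth_intros)

lemma smooth_on_slope:
  assumes "smooth_on E S A" "\<And>x. x \<in> S \<Longrightarrow> invertible (corner P (A x))"
  shows "smooth_on E S (\<lambda>x. slope P (A x))"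
  unfolding slope_def using assms by (intro smooth_intros) (auto simp: invertible_det_nz)

lemma smooth_on_Gr_chart:
  assumes "smooth_on E S A" "\<And>x. x \<in> S \<Longrightarrow> invertible (corner P (A x))"
  shows "smooth_on E S (\<lambda>x. Gr_chart P (A x))"
  unfolding Gr_chart_def Let_def using assms by (intro smooth_intros smooth_on_slope)

lemma smooth_on_Gr_unchart [smooth_intros]:
  "smooth_on E S A \<Longrightarrow> smooth_on E S (\<lambda>x. Gr_unchart P (A x))"
  unfolding Gr_unchart_def Let_def by (intro smooth_intros)

text \<open>The product of the determinants over all modes is one continuous function that vanishes
  exactly where some matrix is singular.\<close>

lemma openin_invertible:
  fixes A :: "'a::euclidean_space \<Rightarrow> 'd::finite \<Rightarrow> real ^ 'n ^ 'n"
  assumes "\<And>k. smooth_on E E (\<lambda>x. A x k)"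
  shows "openin (top_of_set E) {x \<in> E. \<forall>k. invertible (A x k)}"
proof -
  have "continuous_on E (\<lambda>x. \<Prod>k\<in>UNIV. det (A x k))"
    by (intro smooth_on_imp_continuous_on[of E] smooth_intros assms)
  then have "openin (top_of_set E) (E \<inter> (\<lambda>x. \<Prod>k\<in>UNIV. det (A x k)) -` (- {0}))"
    by (intro continuous_openin_preimage_gen) auto
  also have "E \<inter> (\<lambda>x. \<Prod>k\<in>UNIV. det (A x k)) -` (- {0}) = {x \<in> E. \<forall>k. invertible (A x k)}"
    by (auto simp: invertible_det_nz)
  finally show ?thesis .
qed

lemma subspace_tensors: "subspace (tensors I)"
  by (auto simp: subspace_def tensors_def)

lemma subspace_Sym: "subspace (Sym J)"
  by (auto simp: subspace_def Sym_def transpose_add transpose_scalar)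

lemma subspace_ambient_space: "subspace (ambient_space I)"
  using subspace_Sym unfolding ambient_space_def
  by (intro subspace_Times subspace_tensors) (auto simp: subspace_def)

lemma multi_prod_in_tensors:
  assumes "X \<in> tensors I" "\<And>k. coord_proj (I k) ** G k = G k ** coord_proj (I k)"
  shows "multi_prod G X \<in> tensors I"
proof -
  have "mode_prod (multi_prod G X) k (coord_proj (I k)) = multi_prod G (mode_prod X k (coord_proj (I k)))" for k
    by (simp add: mode_prod_multi_prod multi_prod_mode_prod assms(2))
  then show ?thesis
    using assms(1) by (simp add: tensors_iff)
qed

text \<open>The factors in the modes other than \<open>k\<close> are left invertible and can be
  stripped, leaving \<open>A ** G k\<close> in mode \<open>k\<close>. Hence one multilinear map can
  straighten the conditions of all modes.\<close>

lemma mode_prod_multi_prod_eq_0_iff: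
  assumes "\<And>m. H m ** G m = mat 1"
  shows "mode_prod (multi_prod G X) k A = 0 \<longleftrightarrow> mode_prod X k (A ** G k) = 0"
proof
  assume *: "mode_prod (multi_prod G X) k A = 0"
  have "mode_prod X k (A ** G k) = multi_prod (H(k := mat 1)) (mode_prod (multi_prod G X) k A)"
    unfolding mode_prod_multi_prod multi_prod_multi_prod unfolding mode_prod_eq_multi_prod
    by (rule arg_cong[of _ _ "\<lambda>G. multi_prod G X"]) (auto simp: assms)
  then show "mode_prod X k (A ** G k) = 0"
    by (simp add: * linear_0[OF linear_multi_prod])
next
  assume *: "mode_prod X k (A ** G k) = 0"
  have "mode_prod (multi_prod G X) k A = multi_prod (G(k := mat 1)) (mode_prod X k (A ** G k))"
    by (simp add: mode_prod_multi_prod multi_prod_mode_prod)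
  then show "mode_prod (multi_prod G X) k A = 0"
    by (simp add: * linear_0[OF linear_multi_prod])
qed

section \<open>Slice charts of the desingularization\<close>

definition desing_chart ::
    "real ^ 'n ^ 'n ^ 'd \<Rightarrow> (real ^ ('d::finite \<Rightarrow> 'n::finite)) \<times> (real ^ 'n ^ 'n ^ 'd) \<Rightarrow>
      (real ^ ('d \<Rightarrow> 'n)) \<times> (real ^ 'n ^ 'n ^ 'd)"
  where "desing_chart P x =
    (multi_prod (\<lambda>k. mat 1 + slope (P $ k) (snd x $ k)) (fst x), \<chi> k. Gr_chart (P $ k) (snd x $ k))"

text \<open>The slopes are read off as the mixed blocks of the chart coordinates; subtracting them
  from the identity gives the inverse shears.\<close>

definition desing_unchart ::
    "real ^ 'n ^ 'n ^ 'd \<Rightarrow> (real ^ ('d::finite \<Rightarrow> 'n::finite)) \<times> (real ^ 'n ^ 'n ^ 'd) \<Rightarrow>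
      (real ^ ('d \<Rightarrow> 'n)) \<times> (real ^ 'n ^ 'n ^ 'd)"
  where "desing_unchart P y =
    (multi_prod (\<lambda>k. mat 1 - P $ k ** snd y $ k ** (mat 1 - P $ k)) (fst y),
     \<chi> k. Gr_unchart (P $ k) (snd y $ k))"

locale desingularization_point =
  fixes I :: "'d::finite \<Rightarrow> 'n::finite set" and r :: "'d \<Rightarrow> nat" and P :: "real ^ 'n ^ 'n ^ 'd"
  assumes P: "\<And>k. P $ k \<in> Gr (card (I k) - r k) (I k)" and r: "\<And>k. r k \<le> card (I k)"
begin

sublocale proj: supported_projection "P $ k" "coord_proj (I k)" for k
  using P[of k] by unfold_locales (auto simp: Gr_def Sym_iff transpose_coord_proj)

definition U where "U = {x \<in> ambient_space I. \<forall>k. invertible (corner (P $ k) (snd x $ k))}"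

text \<open>Pulls back the condition that defines \<open>U\<close>; as \<open>Gr_unchart\<close> is
  smooth everywhere, openness again follows from determinants.\<close>

definition V where
  "V = {y \<in> ambient_space I. \<forall>k. invertible (corner (P $ k) (Gr_unchart (P $ k) (snd y $ k)))}"

definition L where
  "L = {X \<in> tensors I. \<forall>k. mode_prod X k (P $ k) = 0} \<times>
    {T. \<forall>k. T $ k \<in> Sym (I k) \<and> P $ k ** T $ k ** P $ k = 0 \<and>
      (mat 1 - P $ k) ** T $ k ** (mat 1 - P $ k) = 0}"

lemma ambientD:
  assumes "x \<in> ambient_space I"
  shows "fst x \<in> tensors I" "transpose (snd x $ k) = snd x $ k"
    "coord_proj (I k) ** snd x $ k = snd x $ k"
  using assms by (auto simp: ambient_space_def Sym_iff)

lemma open_U: "openin (top_of_set (ambient_space I)) U"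
  unfolding U_def by (intro openin_invertible smooth_intros)

lemma open_V: "openin (top_of_set (ambient_space I)) V"
  unfolding V_def by (intro openin_invertible smooth_intros)

lemma smooth_desing_chart: "smooth_on (ambient_space I) U (desing_chart P)"
  unfolding desing_chart_def[abs_def]
  by (intro smooth_intros smooth_on_slope smooth_on_Gr_chart) (auto simp: U_def)

lemma smooth_desing_unchart: "smooth_on (ambient_space I) V (desing_unchart P)"
  unfolding desing_unchart_def[abs_def] by (intro smooth_intros)

lemma desing_unchart_chart:
  assumes "x \<in> U"
  shows "desing_unchart P (desing_chart P x) = x"
proof -
  note x = ambientD[of x] assms[unfolded U_def]
  have inv: "invertible (corner (P $ k) (snd x $ k))" for k
    using x by simp
  have sym: "transpose (snd x $ k) = snd x $ k" for k
    using x by simp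
  have "(mat 1 - P $ k ** Gr_chart (P $ k) (snd x $ k) ** (mat 1 - P $ k)) **
      (mat 1 + slope (P $ k) (snd x $ k)) = mat 1" for k
    using proj.Gr_chart_blocks(3)[OF sym inv, of k] base_projection_slope.shear_inverse(4)[OF proj.slope_locale]
    by (simp add: proj.E_def)
  then show ?thesis
    by (simp add: desing_chart_def desing_unchart_def multi_prod_multi_prod
        proj.Gr_unchart_Gr_chart[OF sym inv] prod_eq_iff)
qed

lemma desing_chart_unchart:
  assumes "y \<in> V"
  shows "desing_chart P (desing_unchart P y) = y"
proof -
  note y = ambientD[of y] assms[unfolded V_def]
  have inv: "invertible (corner (P $ k) (Gr_unchart (P $ k) (snd y $ k)))" for k
    using y by simp
  have sym: "transpose (snd y $ k) = snd y $ k" for k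
    using y by simp
  have "(mat 1 + slope (P $ k) (Gr_unchart (P $ k) (snd y $ k))) **
      (mat 1 - P $ k ** snd y $ k ** (mat 1 - P $ k)) = mat 1" for k
    using proj.Gr_unchart_blocks(3)[OF sym inv] base_projection_slope.shear_inverse(3)[OF proj.block_locale]
    by (simp add: proj.E_def)
  then show ?thesis
    by (simp add: desing_chart_def desing_unchart_def multi_prod_multi_prod
        proj.Gr_unchart_blocks(4)[OF sym inv] prod_eq_iff)
qed

lemma desing_chart_in_V:
  assumes "x \<in> U"
  shows "desing_chart P x \<in> V"
proof -
  note x = ambientD[of x] assms[unfolded U_def]
  have inv: "invertible (corner (P $ k) (snd x $ k))" for k
    using x by simp
  have sym: "transpose (snd x $ k) = snd x $ k" "coord_proj (I k) ** snd x $ k = snd x $ k" for k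
    using x by simp_all
  have "multi_prod (\<lambda>k. mat 1 + slope (P $ k) (snd x $ k)) (fst x) \<in> tensors I"
    using x by (intro multi_prod_in_tensors)
      (simp_all add: matrix_add_ldistrib matrix_add_rdistrib proj.support_slope[OF sym])
  moreover have "Gr_chart (P $ k) (snd x $ k) \<in> Sym (I k)" for k
    by (simp add: Sym_iff proj.support_Gr_chart[OF sym] proj.Gr_chart_blocks[OF sym(1) inv])
  ultimately show ?thesis
    by (simp add: V_def ambient_space_def desing_chart_def inv proj.Gr_unchart_Gr_chart[OF sym(1) inv])
qed

lemma desing_unchart_in_U:
  assumes "y \<in> V"
  shows "desing_unchart P y \<in> U"
proof -
  note y = ambientD[of y] assms[unfolded V_def]
  have inv: "invertible (corner (P $ k) (Gr_unchart (P $ k) (snd y $ k)))" for k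
    using y by simp
  have sym: "transpose (snd y $ k) = snd y $ k" "coord_proj (I k) ** snd y $ k = snd y $ k" for k
    using y by simp_all
  define N where "N k = P $ k ** snd y $ k ** (mat 1 - P $ k)" for k
  have N: "coord_proj (I k) ** N k = N k" "N k ** coord_proj (I k) = N k" for k
  proof -
    \<comment> \<open>\<open>N k\<close> is recognised as the slope of the reconstructed matrix, so
      \<open>support_slope\<close> yields its support on both sides.\<close>
    have slope: "slope (P $ k) (Gr_unchart (P $ k) (snd y $ k)) = N k"
      using proj.Gr_unchart_blocks(3)[OF sym(1) inv] by (simp add: proj.E_def N_def)
    note * = proj.Gr_unchart_blocks(2)[OF sym(1)[of k]] proj.support_Gr_unchart[OF sym[of k]]
    show "coord_proj (I k) ** N k = N k" "N k ** coord_proj (I k) = N k"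
      using proj.support_slope(1,3)[OF *] by (simp_all only: slope)
  qed
  have "multi_prod (\<lambda>k. mat 1 - N k) (fst y) \<in> tensors I"
    using y by (intro multi_prod_in_tensors) (simp_all add: matrix_diff_ldistrib matrix_diff_rdistrib N)
  moreover have "Gr_unchart (P $ k) (snd y $ k) \<in> Sym (I k)" for k
    by (simp add: Sym_iff proj.support_Gr_unchart[OF sym] proj.Gr_unchart_blocks(2)[OF sym(1)])
  ultimately show ?thesis
    by (simp add: U_def ambient_space_def desing_unchart_def inv N_def)
qed

lemma homeomorphism_desing_chart: "homeomorphism U V (desing_chart P) (desing_unchart P)"
  by (rule homeomorphismI)
     (auto intro: smooth_on_imp_continuous_on smooth_desing_chart smooth_desing_unchart
        simp: desing_chart_in_V desing_unchart_in_U desing_unchart_chart desing_chart_unchart)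

lemma desing_chart_in_L_iff:
  assumes "x \<in> U"
  shows "desing_chart P x \<in> L \<longleftrightarrow> x \<in> desingularization I r"
proof -
  note x = ambientD[of x] assms[unfolded U_def]
  have inv: "invertible (corner (P $ k) (snd x $ k))" for k
    using x by simp
  have sym: "transpose (snd x $ k) = snd x $ k" for k
    using x by simp
  have Sym: "fst x \<in> tensors I" "snd x $ k \<in> Sym (I k)" for k
    using x by (auto simp: ambient_space_def)
  have chart: "desing_chart P x \<in> ambient_space I"
    using desing_chart_in_V[OF assms] by (simp add: V_def)
  let ?G = "\<lambda>k. mat 1 + slope (P $ k) (snd x $ k)"
  have rank: "rank (P $ k) = card (I k) - r k" for k
    using P[of k] by (simp add: Gr_def)
  have Gr_iff: "snd x $ k \<in> Gr (card (I k) - r k) (I k) \<longleftrightarrow>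
      P $ k ** Gr_chart (P $ k) (snd x $ k) ** P $ k = 0 \<and>
      (mat 1 - P $ k) ** Gr_chart (P $ k) (snd x $ k) ** (mat 1 - P $ k) = 0" for k
    using proj.projection_iff_Gr_chart[OF sym inv] Sym(2)[of k] unfolding proj.E_def
    by (auto simp: Gr_def rank)
  \<comment> \<open>Off the Grassmannian the kernels of \<open>S\<close> and
    \<open>P ** (1 + slope)\<close> may differ, so membership in \<open>Gr\<close> is a premise, and
    the final equivalence treats both conditions jointly.\<close>
  have kernel_iff: "mode_prod (multi_prod ?G (fst x)) k (P $ k) = 0 \<longleftrightarrow> mode_prod (fst x) k (snd x $ k) = 0"
    if Gr: "snd x $ k \<in> Gr (card (I k) - r k) (I k)" for k
  proof -
    have "snd x $ k = snd x $ k ** snd x $ k" "rank (snd x $ k) = rank (P $ k)"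
      using Gr by (simp_all add: Gr_def rank)
    note factor = proj.projection_factor[OF sym inv this]
    obtain B where B: "snd x $ k = B ** (P $ k ** ?G k)"
      using factor(2) by blast
    have "mode_prod (multi_prod ?G (fst x)) k (P $ k) = 0 \<longleftrightarrow> mode_prod (fst x) k (P $ k ** ?G k) = 0"
      using base_projection_slope.shear_inverse(4)[OF proj.slope_locale]
      by (rule mode_prod_multi_prod_eq_0_iff)
    also have "\<dots> \<longleftrightarrow> mode_prod (fst x) k (snd x $ k) = 0"
      using factor(1) B mode_prod_mode_prod[of "fst x" k] mode_prod_0(1) by metis
    finally show ?thesis .
  qed
  have "desing_chart P x \<in> L \<longleftrightarrow>
      (\<forall>k. mode_prod (multi_prod ?G (fst x)) k (P $ k) = 0 \<and> snd x $ k \<in> Gr (card (I k) - r k) (I k))"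
    using chart by (auto simp: L_def ambient_space_def desing_chart_def Gr_iff)
  also have "\<dots> \<longleftrightarrow> x \<in> desingularization I r"
    using kernel_iff Sym(1) by (auto simp: desingularization_def case_prod_beta)
  finally show ?thesis .
qed

lemma subspace_tensor_kernel: "subspace {X \<in> tensors I. \<forall>k. mode_prod X k (P $ k) = 0}"
  using subspace_tensors[of I]
  by (auto simp: subspace_def linear_add[OF linear_mode_prod] linear_scale[OF linear_mode_prod])

lemma subspace_off_diagonal_blocks:
  "subspace {T. \<forall>k. T $ k \<in> Sym (I k) \<and> P $ k ** T $ k ** P $ k = 0 \<and>
    (mat 1 - P $ k) ** T $ k ** (mat 1 - P $ k) = 0}"
  using subspace_Sym
  by (auto simp: subspace_def linear_add[OF linear_matrix_conj] linear_scale[OF linear_matrix_conj])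

lemma subspace_L: "subspace L"
  unfolding L_def by (intro subspace_Times subspace_tensor_kernel subspace_off_diagonal_blocks)

lemma dim_L: "dim L = (\<Prod>k\<in>UNIV. r k) + (\<Sum>k\<in>UNIV. r k * (card (I k) - r k))"
  unfolding L_def dim_Times[OF subspace_tensor_kernel subspace_off_diagonal_blocks]
    dim_tensor_kernel[OF P r] dim_off_diagonal_blocks[OF P r] ..

text \<open>The corner of \<open>P\<close> relative to itself is \<open>P + (1 - P)\<close>, the
  identity.\<close>

lemma base_point_in_U: "X \<in> tensors I \<Longrightarrow> (X, P) \<in> U"
  using P by (auto simp: U_def ambient_space_def Gr_def corner_def proj.idem invertible_det_nz det_I)

end

theorem theorem1:
  fixes I :: "'d::finite \<Rightarrow> 'n::finite set"
    and n r :: "'d \<Rightarrow> nat"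
  assumes "\<And>k. card (I k) = n k"
    and "\<And>k. 0 < n k"
    and "\<And>k. 0 < r k"
    and "\<And>k. r k \<le> n k"
  shows "embedded_submanifold (ambient_space I) (desingularization I r)
           ((\<Prod>k\<in>UNIV. r k) + (\<Sum>k\<in>UNIV. r k * (n k - r k)))"
proof -
  have r: "r k \<le> card (I k)" for k
    using assms by simp
  have "\<forall>k. \<exists>K. K \<subseteq> I k \<and> card K = card (I k) - r k"
    by (meson diff_le_self obtain_subset_with_card_n)
  then obtain K where K: "\<And>k. K k \<subseteq> I k" "\<And>k. card (K k) = card (I k) - r k"
    using choice[of "\<lambda>k K. K \<subseteq> I k \<and> card K = card (I k) - r k"] by blast
  \<comment> \<open>The zero tensor satisfies every kernel condition, so coordinate projections of
    the right ranks complete a point of the set.\<close>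
  have "(0, \<chi> k. coord_proj (K k)) \<in> desingularization I r"
    using coord_proj_in_Gr[OF K(1)] K(2) by (simp add: desingularization_def tensors_def)
  then have nonempty: "desingularization I r \<noteq> {}"
    by blast
  have subset: "desingularization I r \<subseteq> ambient_space I"
    by (auto simp: desingularization_def ambient_space_def Gr_def)
  have "\<exists>U V L \<phi> \<psi>. openin (top_of_set (ambient_space I)) U \<and> p \<in> U \<and>
      openin (top_of_set (ambient_space I)) V \<and> homeomorphism U V \<phi> \<psi> \<and>
      smooth_on (ambient_space I) U \<phi> \<and> smooth_on (ambient_space I) V \<psi> \<and>
      subspace L \<and> L \<subseteq> ambient_space I \<and>
      dim L = (\<Prod>k\<in>UNIV. r k) + (\<Sum>k\<in>UNIV. r k * (n k - r k)) \<and>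
      \<phi> ` (U \<inter> desingularization I r) = V \<inter> L"
    if p: "p \<in> desingularization I r" for p
  proof -
    obtain X P where p_eq: "p = (X, P)" and X: "X \<in> tensors I"
      and P: "\<And>k. P $ k \<in> Gr (card (I k) - r k) (I k)"
      using p by (auto simp: desingularization_def)
    \<comment> \<open>The chart is centred at the matrix component alone; its domain contains
      \<open>(X, P)\<close> for every \<open>X\<close> in \<open>tensors I\<close>.\<close>
    interpret desingularization_point I r P
      using P r by unfold_locales
    have "desing_chart P ` (U \<inter> desingularization I r) = V \<inter> L"
    proof (intro equalityI subsetI)
      fix y assume y: "y \<in> V \<inter> L"
      then have eq: "desing_chart P (desing_unchart P y) = y" and U: "desing_unchart P y \<in> U"
        using desing_chart_unchart desing_unchart_in_U by simp_all
      then have "desing_unchart P y \<in> desingularization I r"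
        using desing_chart_in_L_iff[OF U] y by simp
      then show "y \<in> desing_chart P ` (U \<inter> desingularization I r)"
        using U eq by (metis IntI image_eqI)
    qed (auto simp: desing_chart_in_V desing_chart_in_L_iff)
    moreover have "L \<subseteq> ambient_space I"
      by (auto simp: L_def ambient_space_def)
    ultimately show ?thesis
      using open_U base_point_in_U[OF X] open_V homeomorphism_desing_chart smooth_desing_chart
        smooth_desing_unchart subspace_L dim_L
      unfolding p_eq assms(1) by blast
  qed
  then show ?thesis
    unfolding embedded_submanifold_def using subspace_ambient_space subset nonempty by blast
qed

end
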